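(* Let $F_k$ be the Fibonacci sequence defined by $F_0=0$, $F_1=1$ and $F_{k+2}=F_{k+1}+F_k$. Let $D_n$ be the closure of the $3$-braid $(\sigma_1\sigma_2^{-1})^n$, that is, $D_n=D(W_n)$, the Tait diagram of the wheel graph $W_n$ with $n$ spokes. Then the reduced group of Fox colorings of $D_n$ is $$Col^{red}(D_n)=\begin{cases}\mathbb Z_{F_{n-1}+F_{n+1}}\oplus\mathbb Z_{F_{n-1}+F_{n+1}} & \text{when } n \text{ is odd},\\ \mathbb Z_{5F_n}\oplus\mathbb Z_{F_n} & \text{when } n\text{ is even}.\end{cases}$$ In particular, for $n=2,3,4,5,6,7$ we have $\mathbb Z_5$, $\mathbb Z_4\oplus\mathbb Z_4$, $\mathbb Z_{15}\oplus\mathbb Z_3$, $\mathbb Z_{11}\oplus\mathbb Z_{11}$, $\mathbb Z_{40}\oplus\mathbb Z_8$ and $\mathbb Z_{29}\oplus\mathbb Z_{29}$, respectively.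
   Context: $\mathbb Z_m=\mathbb Z/m\mathbb Z$, and equality of groups means isomorphism. The Tait diagram of a plane graph is the alternating link diagram obtained by replacing every edge by a crossing and connecting the loose endpoints of the crossings along the edges. An arc of a link diagram $D$ is a part of the diagram from undercrossing to undercrossing; components without a crossing also count as arcs. The group $Col(D)$ is the abelian group whose generators are indexed by the arcs of $D$ (the set of generators is denoted $Arcs(D)$), with one relation $2b-a-c=0$ for each crossing, where $b$ is the overarc and $a,c$ are the two underarcs at the crossing. The group of trivial colorings $Col^{trivial}(D)\le Col(D)$ is the subgroup generated by the element $\sum_{a_i\in Arcs(D)}a_i$, the sum being over all arcs of $D$. The reduced group of Fox colorings is the quotient $Col^{red}(D)=Col(D)/Col^{trivial}(D)$; that is, it has generators $Arcs(D)$, the crossing relations $2b-a-c=0$, and the additional relation $\sum_{a_i\in Arcs(D)}a_i=0$.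
   Formalization: The reduced group is taken as Col(D) modulo the subgroup generated by a single arc (proved for every arc), not modulo the sum of all arcs: the latter quotient maps onto Z_{2n}, so the stated formula fails for it (e.g. n=2). *)

theory Defs
  imports
    "HOL-Algebra.Free_Abelian_Groups"
    "HOL-Algebra.Elementary_Groups"
    "HOL-Algebra.Multiplicative_Group"
    "HOL-Number_Theory.Fib"
begin

section \<open>Link diagrams and their arcs\<close>

text \<open>
  A diagram is given by its segments: pieces of strand short enough to contain no crossing in
  their interior. At a crossing \<open>c\<close>, \<open>over c\<close> is the pair of segments joined
  by the overpassing strand and \<open>under c\<close> is the pair separated by the underpassing
  strand; \<open>joins\<close> lists the pairs of segments that follow each other with no crossing
  in between. Orientation is irrelevant, and so is the order inside each pair.
\<close>

record ('s, 'c) link_diagram =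
  segments :: "'s set"
  joins :: "('s \<times> 's) set"
  crossings :: "'c set"
  over :: "'c \<Rightarrow> 's \<times> 's"
  under :: "'c \<Rightarrow> 's \<times> 's"

definition continues :: "('s, 'c) link_diagram \<Rightarrow> 's rel" where
  "continues D = joins D \<union> over D ` crossings D"

definition arc_rel :: "('s, 'c) link_diagram \<Rightarrow> 's rel" where
  "arc_rel D = (continues D \<union> (continues D)\<inverse>)\<^sup>* \<inter> (segments D \<times> segments D)"

text \<open>
  An arc is the set of segments met when following the link until an undercrossing is reached in
  either direction; a component without undercrossing is a single arc.
\<close>

definition arcs :: "('s, 'c) link_diagram \<Rightarrow> 's set set" where
  "arcs D = segments D // arc_rel D"

definition arc_of :: "('s, 'c) link_diagram \<Rightarrow> 's \<Rightarrow> 's set" where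
  "arc_of D s = arc_rel D `` {s}"

section \<open>The groups of Fox colorings\<close>

definition crossing_relator :: "('s, 'c) link_diagram \<Rightarrow> 'c \<Rightarrow> ('s set \<Rightarrow>\<^sub>0 int)" where
  "crossing_relator D c =
     frag_cmul 2 (frag_of (arc_of D (fst (over D c))))
       - frag_of (arc_of D (fst (under D c))) - frag_of (arc_of D (snd (under D c)))"

definition coloring_relations :: "('s, 'c) link_diagram \<Rightarrow> ('s set \<Rightarrow>\<^sub>0 int) set" where
  "coloring_relations D =
     generate (free_Abelian_group (arcs D)) (crossing_relator D ` crossings D)"

definition Col :: "('s, 'c) link_diagram \<Rightarrow> ('s set \<Rightarrow>\<^sub>0 int) set monoid" where
  "Col D = free_Abelian_group (arcs D) Mod coloring_relations D"

definition col_class :: "('s, 'c) link_diagram \<Rightarrow> ('s set \<Rightarrow>\<^sub>0 int) \<Rightarrow> ('s set \<Rightarrow>\<^sub>0 int) set" where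
  "col_class D x = coloring_relations D #>\<^bsub>free_Abelian_group (arcs D)\<^esub> x"

text \<open>
  The reduced group is \<open>Col D\<close> modulo trivial colorings, i.e. with one arc \<open>a\<close>
  set to zero. It is sometimes described instead as \<open>Col D\<close> modulo the sum of all arcs;
  that sum is the constant coloring when colorings are regarded as functions on the arcs, but in
  the group presented by arcs and crossing relations it does not give the intended quotient:
  sending every arc to 1 maps \<open>Col D\<close> modulo that sum onto the integers modulo the
  number of arcs. See \<open>card_arcs_dvd_order_Col_mod_sum\<close> and
  \<open>figure_eight_Col_mod_sum\<close> below.
\<close>

definition Col_red :: "('s, 'c) link_diagram \<Rightarrow> 's set \<Rightarrow> ('s set \<Rightarrow>\<^sub>0 int) set set monoid" where
  "Col_red D a = Col D Mod generate (Col D) {col_class D (frag_of a)}"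

text \<open>The choice of the arc set to zero is immaterial, so all choices are required to agree.\<close>

definition has_Col_red :: "('s, 'c) link_diagram \<Rightarrow> ('g, 'm) monoid_scheme \<Rightarrow> bool" where
  "has_Col_red D G \<longleftrightarrow> arcs D \<noteq> {} \<and> (\<forall>a\<in>arcs D. Col_red D a \<cong> G)"

section \<open>Closed braids\<close>

datatype braid_letter = Gen nat | Gen_inv nat

text \<open>
  Strand positions are \<open>1..m\<close>; the segment \<open>(t, p)\<close> is the piece at position
  \<open>p\<close> between letters \<open>t\<close> and \<open>t + 1\<close> of the word. In
  \<open>Gen i\<close> the strand moving from position \<open>i\<close> to \<open>i + 1\<close> passes
  over, in \<open>Gen_inv i\<close> the strand moving from \<open>i + 1\<close> to \<open>i\<close> does.
\<close>

fun letter_pos :: "braid_letter \<Rightarrow> nat" where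
  "letter_pos (Gen i) = i"
| "letter_pos (Gen_inv i) = i"

fun letter_over :: "nat \<Rightarrow> braid_letter \<Rightarrow> (nat \<times> nat) \<times> (nat \<times> nat)" where
  "letter_over t (Gen i) = ((t, i), (t + 1, i + 1))"
| "letter_over t (Gen_inv i) = ((t, i + 1), (t + 1, i))"

fun letter_under :: "nat \<Rightarrow> braid_letter \<Rightarrow> (nat \<times> nat) \<times> (nat \<times> nat)" where
  "letter_under t (Gen i) = ((t, i + 1), (t + 1, i))"
| "letter_under t (Gen_inv i) = ((t, i), (t + 1, i + 1))"

definition braid_closure :: "nat \<Rightarrow> braid_letter list \<Rightarrow> (nat \<times> nat, nat) link_diagram" where
  "braid_closure m w =
     \<lparr>segments = {0..length w} \<times> {1..m},
      joins = {((t, p), (t + 1, p)) | t p. t < length w \<and> p \<in> {1..m} \<and>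
                  p \<noteq> letter_pos (w ! t) \<and> p \<noteq> letter_pos (w ! t) + 1}
              \<union> {((length w, p), (0, p)) | p. p \<in> {1..m}},
      crossings = {..<length w},
      over = (\<lambda>t. letter_over t (w ! t)),
      under = (\<lambda>t. letter_under t (w ! t))\<rparr>"

definition wheel_closed_braid :: "nat \<Rightarrow> (nat \<times> nat, nat) link_diagram" where
  "wheel_closed_braid n = braid_closure 3 (concat (replicate n [Gen 1, Gen_inv 2]))"

section \<open>Tait diagrams of plane graphs\<close>

text \<open>
  A plane graph without isolated vertices is given by a rotation system: each edge \<open>e\<close>
  has the two ends \<open>(e, True)\<close> and \<open>(e, False)\<close>, and \<open>rotation\<close>
  sends an edge end to the next one counterclockwise around its vertex.
\<close>

record 'e plane_graph =
  edges :: "'e set"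
  rotation :: "'e \<times> bool \<Rightarrow> 'e \<times> bool"

text \<open>
  Each segment of the Tait diagram runs through a corner of the graph, from the crossing on one
  edge to the crossing on the next edge of the corner; the corner is named after its
  counterclockwise-last edge end \<open>d\<close>, so that it is the corner to the right of
  \<open>d\<close> seen from the vertex, and the corner to the left of \<open>d\<close> is
  \<open>rotation G d\<close>. Of the two strands crossing an edge, one connects the right corners of
  the two ends and the other one the left corners. Letting the former pass over at every edge
  makes the diagram alternating, as a corner is on the right of one of its edge ends and on the
  left of the other. The opposite choice gives the mirror image.
\<close>

definition tait_diagram :: "'e plane_graph \<Rightarrow> ('e \<times> bool, 'e) link_diagram" where
  "tait_diagram G =
     \<lparr>segments = edges G \<times> UNIV,
      joins = {},
      crossings = edges G,
      over = (\<lambda>e. ((e, True), (e, False))),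
      under = (\<lambda>e. (rotation G (e, True), rotation G (e, False)))\<rparr>"

datatype wheel_edge = Spoke nat | Rim nat

text \<open>
  Rim vertices are numbered counterclockwise modulo \<open>n\<close>. \<open>Spoke i\<close> joins the
  hub (end \<open>True\<close>) to rim vertex \<open>i\<close>; \<open>Rim i\<close> joins rim vertex
  \<open>i\<close> (end \<open>True\<close>) to rim vertex \<open>i + 1\<close>. For \<open>n = 1\<close> the
  rim is a loop, for \<open>n = 2\<close> it consists of two parallel edges.
\<close>

fun wheel_rotation :: "nat \<Rightarrow> wheel_edge \<times> bool \<Rightarrow> wheel_edge \<times> bool" where
  "wheel_rotation n (Spoke i, True) = (Spoke ((i + 1) mod n), True)"
| "wheel_rotation n (Spoke i, False) = (Rim ((i + n - 1) mod n), False)"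
| "wheel_rotation n (Rim i, False) = (Rim ((i + 1) mod n), True)"
| "wheel_rotation n (Rim i, True) = (Spoke i, False)"

definition wheel_graph :: "nat \<Rightarrow> wheel_edge plane_graph" where
  "wheel_graph n = \<lparr>edges = Spoke ` {..<n} \<union> Rim ` {..<n}, rotation = wheel_rotation n\<rparr>"

section \<open>Why the sum of all arcs is not used\<close>

definition Col_mod_sum :: "('s, 'c) link_diagram \<Rightarrow> ('s set \<Rightarrow>\<^sub>0 int) set set monoid" where
  "Col_mod_sum D = Col D Mod generate (Col D) {col_class D (\<Sum>a\<in>arcs D. frag_of a)}"

lemma card_arcs_dvd_order_Col_mod_sum:
  fixes D :: "('s, 'c) link_diagram"
  assumes fin: "finite (arcs D)" and ne: "arcs D \<noteq> {}"
    and over_in: "\<And>c. c \<in> crossings D \<Longrightarrow> fst (over D c) \<in> segments D"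
    and under_in: "\<And>c. c \<in> crossings D \<Longrightarrow>
                  fst (under D c) \<in> segments D \<and> snd (under D c) \<in> segments D"
  shows "card (arcs D) dvd order (Col_mod_sum D)"
proof -
  let ?F = "free_Abelian_group (arcs D)" and ?R = "coloring_relations D"
  define N where "N = card (arcs D)"
  have N: "N > 0" using fin ne by (simp add: N_def card_gt_0_iff)
  define e :: "('s set \<Rightarrow>\<^sub>0 int) \<Rightarrow> int"
    where "e x = poly_mapping.lookup (frag_extend (\<lambda>_. frag_of ()) x) ()" for x
  have e_simps: "e 0 = 0" "e (x + y) = e x + e y" "e (x - y) = e x - e y"
    "e (frag_cmul k x) = k * e x" "e (frag_of a) = 1" for x y k a
    by (auto simp: e_def frag_extend_add frag_extend_diff frag_extend_cmul lookup_add lookup_minus)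
  have e_sum: "e (\<Sum>a\<in>A. frag_of a) = int (card A)" if "finite A" for A
    using that by (induction A rule: finite_induct) (auto simp: e_simps)
  let ?Z = "integer_mod_group N"
  interpret F: comm_group ?F by (rule abelian_free_Abelian_group)
  interpret Z: comm_group ?Z by simp
  define h where "h x = e x mod int N" for x
  have h: "h \<in> hom ?F ?Z"
    using N by (auto simp: hom_def h_def e_simps carrier_integer_mod_group mod_add_eq)
  interpret h: group_hom ?F ?Z h
    using h by (simp add: group_hom_def group_hom_axioms_def)
  have arc_in: "arc_of D s \<in> arcs D" if "s \<in> segments D" for s
    using that by (simp add: arcs_def arc_of_def quotientI)
  have rel_carrier: "crossing_relator D ` crossings D \<subseteq> carrier ?F"
  proof clarify
    fix c assume c: "c \<in> crossings D"
    let ?a = "arc_of D (fst (over D c))" and ?b = "arc_of D (fst (under D c))"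
      and ?d = "arc_of D (snd (under D c))"
    have "Poly_Mapping.keys (crossing_relator D c) \<subseteq> {?a, ?b, ?d}"
      unfolding crossing_relator_def
      by (auto simp: in_keys_iff lookup_minus split: if_splits)
    then show "crossing_relator D c \<in> carrier ?F"
      using arc_in over_in[OF c] under_in[OF c] by auto
  qed
  have R_sub: "subgroup ?R ?F"
    unfolding coloring_relations_def by (rule F.generate_is_subgroup[OF rel_carrier])
  have R_norm: "?R \<lhd> ?F" by (rule F.subgroup_imp_normal[OF R_sub])
  have "?R \<subseteq> kernel ?F ?Z h"
    unfolding coloring_relations_def
  proof (rule F.generate_subgroup_incl)
    have "h (crossing_relator D c) = 0" for c
      by (simp add: h_def crossing_relator_def e_simps)
    then show "crossing_relator D ` crossings D \<subseteq> kernel ?F ?Z h"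
      using rel_carrier by (auto simp: kernel_def simp del: carrier_free_Abelian_group_iff)
  qed (rule h.subgroup_kernel)
  then have hR: "h r = 0" if "r \<in> ?R" for r
    using that by (auto simp: kernel_def)
  have h_coset: "h x = h y"
    if xy: "x \<in> carrier ?F" "y \<in> carrier ?F" "?R #>\<^bsub>?F\<^esub> x = ?R #>\<^bsub>?F\<^esub> y" for x y
  proof -
    have "x \<in> ?R #>\<^bsub>?F\<^esub> y"
      using F.rcos_self[OF xy(1) R_sub] xy(3) by simp
    then obtain r where r: "r \<in> ?R" "x = r + y" by (auto simp: r_coset_def)
    have "e r mod int N = 0" using hR[OF r(1)] by (simp add: h_def)
    then show ?thesis
      unfolding h_def r(2) e_simps by (metis add_0 mod_add_left_eq)
  qed
  obtain g where g: "g \<in> hom (Col D) ?Z"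
    and gx: "\<And>x. x \<in> carrier ?F \<Longrightarrow> g (col_class D x) = h x"
    unfolding Col_def col_class_def
    using FactGroup_universal[OF h R_norm h_coset] by blast
  interpret C: comm_group "Col D"
    unfolding Col_def by (rule F.abelian_FactGroup[OF R_sub])
  interpret g: group_hom "Col D" ?Z g
    using g by (simp add: group_hom_def group_hom_axioms_def)
  have cls: "col_class D x \<in> carrier (Col D)" if "x \<in> carrier ?F" for x
    using that by (auto simp: Col_def col_class_def carrier_FactGroup)
  let ?s = "\<Sum>a\<in>arcs D. frag_of a"
  let ?T = "generate (Col D) {col_class D ?s}"
  have s_in: "?s \<in> carrier ?F"
    using keys_sum[of frag_of "arcs D"] by auto
  have T_sub: "subgroup ?T (Col D)"
    using cls[OF s_in] by (intro C.generate_is_subgroup) auto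
  have T_norm: "?T \<lhd> Col D" by (rule C.subgroup_imp_normal[OF T_sub])
  have "?T \<subseteq> kernel (Col D) ?Z g"
  proof (rule C.generate_subgroup_incl)
    show "{col_class D ?s} \<subseteq> kernel (Col D) ?Z g"
      using cls[OF s_in] gx[OF s_in] by (auto simp: kernel_def h_def e_sum fin N_def)
  qed (rule g.subgroup_kernel)
  then have gT: "g t = 0" if "t \<in> ?T" for t
    using that by (auto simp: kernel_def)
  have g_coset: "g x = g y"
    if xy: "x \<in> carrier (Col D)" "y \<in> carrier (Col D)"
      "?T #>\<^bsub>Col D\<^esub> x = ?T #>\<^bsub>Col D\<^esub> y" for x y
  proof -
    have "x \<in> ?T #>\<^bsub>Col D\<^esub> y"
      using C.rcos_self[OF xy(1) T_sub] xy(3) by simp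
    then obtain t where t: "t \<in> ?T" "x = t \<otimes>\<^bsub>Col D\<^esub> y" by (auto simp: r_coset_def)
    have "t \<in> carrier (Col D)" using t(1) T_sub subgroup.subset by blast
    then have "g x = (g t + g y) mod int N" using t xy by simp
    also have "\<dots> = g y"
      using gT[OF t(1)] g.hom_closed[OF xy(2)] N by (auto simp: carrier_integer_mod_group)
    finally show ?thesis .
  qed
  obtain k where k: "k \<in> hom (Col_mod_sum D) ?Z"
    and kx: "\<And>x. x \<in> carrier (Col D) \<Longrightarrow> k (?T #>\<^bsub>Col D\<^esub> x) = g x"
    unfolding Col_mod_sum_def using FactGroup_universal[OF g T_norm g_coset] by blast
  interpret M: comm_group "Col_mod_sum D"
    unfolding Col_mod_sum_def by (rule C.abelian_FactGroup[OF T_sub])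
  interpret k: group_hom "Col_mod_sum D" ?Z k
    using k by (simp add: group_hom_def group_hom_axioms_def)
  obtain a where a: "a \<in> arcs D" using ne by auto
  have fa: "frag_of a \<in> carrier ?F" using a by simp
  define u where "u = ?T #>\<^bsub>Col D\<^esub> (col_class D (frag_of a))"
  have u: "u \<in> carrier (Col_mod_sum D)"
    using cls[OF fa] by (auto simp: u_def Col_mod_sum_def carrier_FactGroup)
  have ku: "k u = 1 mod int N"
    unfolding u_def using kx[OF cls[OF fa]] gx[OF fa] by (simp add: h_def e_simps)
  have "k (u [^]\<^bsub>Col_mod_sum D\<^esub> order (Col_mod_sum D)) = 0"
    using M.pow_order_eq_1[OF u] k.hom_one by simp
  then have "int (order (Col_mod_sum D)) mod int N = 0"
    using k.hom_nat_pow[OF u] ku by (simp add: mod_mult_right_eq)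
  then show ?thesis by (simp add: N_def mod_eq_0_iff_dvd)
qed

lemma card_arcs_by_label:
  assumes cont: "continues D \<subseteq> segments D \<times> segments D"
    and label: "\<And>s t. (s, t) \<in> continues D \<Longrightarrow> f s = f t"
    and conn: "\<And>s. s \<in> segments D \<Longrightarrow> (s, r (f s)) \<in> arc_rel D"
  shows "card (arcs D) = card (f ` segments D)"
proof -
  have lab: "f s = f t" if "(s, t) \<in> arc_rel D" for s t
  proof -
    have "(s, t) \<in> (continues D \<union> (continues D)\<inverse>)\<^sup>*" using that by (simp add: arc_rel_def)
    then show ?thesis by (induction rule: rtrancl_induct) (use label in auto)
  qed
  have rel_iff: "(s, t) \<in> arc_rel D \<longleftrightarrow> f s = f t"
    if "s \<in> segments D" "t \<in> segments D" for s t
  proof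
    assume "f s = f t"
    have sym: "sym ((continues D \<union> (continues D)\<inverse>)\<^sup>*)"
      by (intro sym_rtrancl sym_Un_converse)
    have "(s, r (f s)) \<in> (continues D \<union> (continues D)\<inverse>)\<^sup>*"
      "(t, r (f s)) \<in> (continues D \<union> (continues D)\<inverse>)\<^sup>*"
      using conn[OF that(1)] conn[OF that(2)] \<open>f s = f t\<close> by (auto simp: arc_rel_def)
    then have "(s, t) \<in> (continues D \<union> (continues D)\<inverse>)\<^sup>*"
      using symD[OF sym] rtrancl_trans by metis
    then show "(s, t) \<in> arc_rel D" using that by (simp add: arc_rel_def)
  qed (rule lab)
  have cls: "arc_rel D `` {s} = {t \<in> segments D. f t = f s}" if "s \<in> segments D" for s
  proof -
    have "t \<in> segments D" if "(s, t) \<in> arc_rel D" for t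
      using that by (simp add: arc_rel_def)
    then show ?thesis using rel_iff[OF that] by fastforce
  qed
  have "bij_betw (\<lambda>k. {t \<in> segments D. f t = k}) (f ` segments D) (arcs D)"
    unfolding bij_betw_def
  proof
    show "inj_on (\<lambda>k. {t \<in> segments D. f t = k}) (f ` segments D)"
      by (rule inj_onI) blast
    show "(\<lambda>k. {t \<in> segments D. f t = k}) ` f ` segments D = arcs D"
      by (simp add: arcs_def quotient_def image_image cls UNION_singleton_eq_range)
  qed
  then have "card (f ` segments D) = card (arcs D)" by (rule bij_betw_same_card)
  then show ?thesis by simp
qed

lemma card_arcs_figure_eight: "card (arcs (wheel_closed_braid 2)) = 4"
proof -
  let ?D = "wheel_closed_braid 2"
  define A :: "(nat \<times> nat) list list" where
    "A = [[(0,1), (1,2), (3,1), (4,1)], [(0,3), (1,3), (2,2), (4,3)],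
          [(1,1), (2,1), (3,2)], [(2,3), (3,3), (4,2), (0,2)]]"
  define f :: "nat \<times> nat \<Rightarrow> nat" where
    "f s = (if s \<in> set (A ! 0) then 0 else if s \<in> set (A ! 1) then 1
            else if s \<in> set (A ! 2) then 2 else 3)" for s
  define r :: "nat \<Rightarrow> nat \<times> nat" where "r k = A ! k ! 0" for k
  have w: "concat (replicate 2 [Gen 1, Gen_inv 2]) = [Gen 1, Gen_inv 2, Gen 1, Gen_inv 2]"
    by (simp add: numeral_2_eq_2)
  have sets: "{0..Suc (Suc (Suc (Suc 0)))} = {0, 1, 2, 3, 4}" "{Suc 0..3} = {1, 2, 3}" by auto
  have seg: "segments ?D = {(0,1), (0,2), (0,3), (1,1), (1,2), (1,3), (2,1), (2,2), (2,3),
      (3,1), (3,2), (3,3), (4,1), (4,2), (4,3)}"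
    unfolding wheel_closed_braid_def braid_closure_def w by (simp add: sets Sigma_def insert_commute)
  define K :: "(nat \<times> nat) rel" where
    "K = {((0,3),(1,3)), ((1,1),(2,1)), ((2,3),(3,3)), ((3,1),(4,1)),
      ((4,1),(0,1)), ((4,2),(0,2)), ((4,3),(0,3)),
      ((0,1),(1,2)), ((1,3),(2,2)), ((2,1),(3,2)), ((3,3),(4,2))}"
  have cont: "continues ?D = K"
  proof -
    have ov: "over ?D ` crossings ?D = {((0,1),(1,2)), ((1,3),(2,2)), ((2,1),(3,2)), ((3,3),(4,2))}"
      unfolding wheel_closed_braid_def braid_closure_def w
      by (simp add: lessThan_Suc eval_nat_numeral insert_commute)
    have jn: "joins (braid_closure m v) =
        (\<Union>t\<in>{..<length v}. \<Union>p\<in>{1..m}.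
           if p = letter_pos (v ! t) \<or> p = letter_pos (v ! t) + 1 then {} else {((t, p), (t + 1, p))})
        \<union> (\<Union>p\<in>{1..m}. {((length v, p), (0, p))})" for m v
      by (auto simp: braid_closure_def split: if_splits)
    have "joins ?D = {((0,3),(1,3)), ((1,1),(2,1)), ((2,3),(3,3)), ((3,1),(4,1)),
      ((4,1),(0,1)), ((4,2),(0,2)), ((4,3),(0,3))}"
      unfolding wheel_closed_braid_def w jn
      by (simp add: lessThan_Suc atLeastAtMostSuc_conv eval_nat_numeral insert_commute)
    then show ?thesis unfolding continues_def ov K_def by (simp only: Un_insert_left Un_empty_left)
  qed
  define S where "S = (K \<union> K\<inverse>)\<^sup>*"
  have step: "(s, t) \<in> S" if "(s, t) \<in> K \<or> (t, s) \<in> K" for s t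
    using that unfolding S_def by blast
  have chain: "(s, u) \<in> S" if "(s, t) \<in> S" "(t, u) \<in> S" for s t u
    using that unfolding S_def by (rule rtrancl_trans)
  have one: "((4,1),(0,1)) \<in> S" "((1,2),(0,1)) \<in> S" "((1,3),(0,3)) \<in> S" "((4,3),(0,3)) \<in> S"
      "((2,1),(1,1)) \<in> S" "((3,3),(2,3)) \<in> S" "((3,1),(4,1)) \<in> S" "((2,2),(1,3)) \<in> S"
      "((3,2),(2,1)) \<in> S" "((4,2),(3,3)) \<in> S" "((0,2),(4,2)) \<in> S"
    by (rule step; simp add: K_def)+
  have two: "((3,1),(0,1)) \<in> S" "((2,2),(0,3)) \<in> S" "((3,2),(1,1)) \<in> S" "((4,2),(2,3)) \<in> S"
    by (fact chain[OF one(7) one(1)] chain[OF one(8) one(3)] chain[OF one(9) one(5)]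
          chain[OF one(10) one(6)])+
  have three: "((0,2),(2,3)) \<in> S" by (fact chain[OF one(11) two(4)])
  have refl: "(s, s) \<in> S" for s unfolding S_def by simp
  have "card (arcs ?D) = card (f ` segments ?D)"
  proof (rule card_arcs_by_label[where r = r])
    show "continues ?D \<subseteq> segments ?D \<times> segments ?D" unfolding cont seg K_def by simp
    show "f s = f t" if "(s, t) \<in> continues ?D" for s t
      using that unfolding cont K_def by (elim insertE emptyE; simp add: f_def A_def)
    show "(s, r (f s)) \<in> arc_rel ?D" if "s \<in> segments ?D" for s
    proof -
      have "(s, r (f s)) \<in> S"
        using that unfolding seg
        by (elim insertE emptyE; simp add: f_def r_def A_def one[simplified] two[simplified] three refl)
      moreover have "r (f s) \<in> segments ?D"
        using that unfolding seg by (elim insertE emptyE; simp add: f_def r_def A_def)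
      ultimately show ?thesis
        using that by (simp add: arc_rel_def cont S_def)
    qed
  qed
  also have "f ` segments ?D = {0, 1, 2, 3}" unfolding seg by (simp add: f_def A_def insert_commute)
  finally show ?thesis by simp
qed

lemma figure_eight_Col_mod_sum:
  "\<not> Col_mod_sum (wheel_closed_braid 2) \<cong> integer_mod_group 5"
proof
  let ?D = "wheel_closed_braid 2"
  assume iso: "Col_mod_sum ?D \<cong> integer_mod_group 5"
  have w: "concat (replicate 2 [Gen 1, Gen_inv 2]) = [Gen 1, Gen_inv 2, Gen 1, Gen_inv 2]"
    by (simp add: numeral_2_eq_2)
  have "card (arcs ?D) dvd order (Col_mod_sum ?D)"
  proof (rule card_arcs_dvd_order_Col_mod_sum)
    show "finite (arcs ?D)" using card_arcs_figure_eight card.infinite by fastforce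
    show "arcs ?D \<noteq> {}" using card_arcs_figure_eight by auto
  qed (auto simp: wheel_closed_braid_def braid_closure_def w less_Suc_eq numeral_2_eq_2 numeral_3_eq_3)
  moreover have "order (Col_mod_sum ?D) = 5"
    using iso_same_card[OF iso] by (simp add: order_def carrier_integer_mod_group)
  ultimately show False by (simp add: card_arcs_figure_eight)
qed

end

theory Submission
  imports Defs
begin

text \<open>
  The arcs of both diagrams can be indexed by the integers modulo \<open>2 * n\<close> so that
  the crossing relations read \<open>x (k + 3) + x k = 2 * x (k + 2)\<close>. The characteristic
  polynomial is \<open>(X - 1) * (X\<^sup>2 - X - 1)\<close>, so the differences of consecutive
  arcs form a Fibonacci sequence. Once \<open>x 0 = 0\<close>, everything is determined by
  \<open>a = x 1\<close> and \<open>b = x 2 - x 1\<close>, and periodicity is the only remaining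
  condition: the group is the cokernel of \<open>M\<^sup>2\<^sup>n - 1\<close> for the
  Fibonacci matrix \<open>M\<close>. Since \<open>det M = -1\<close>, the identity
  \<open>M\<^sup>2\<^sup>n - 1 = M\<^sup>n * (M\<^sup>n - M\<^sup>-\<^sup>n)\<close> and
  Cayley-Hamilton reduce this matrix, up to the unimodular factor \<open>M\<^sup>n\<close>, to
  \<open>F (n - 1) + F (n + 1)\<close> times the identity for odd \<open>n\<close>, and to
  \<open>F n * (2 * M - 1)\<close> with \<open>det (2 * M - 1) = -5\<close> for even \<open>n\<close>.
\<close>

section \<open>Fibonacci shift identities over the integers\<close>

text \<open>\<open>M\<^sup>-\<^sup>n\<close> for the Fibonacci matrix \<open>M\<close>, kept free of negative indices.\<close>

lemma fib_backward:
  "(- 1) ^ n * int (fib k) = int (fib (n + 1)) * int (fib (k + n)) - int (fib n) * int (fib (k + n + 1))"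
  by (induction n arbitrary: k) (simp_all add: algebra_simps)

lemma fib_forward:
  assumes "n > 0"
  shows "int (fib (k + n)) = int (fib n) * int (fib (k + 1)) + int (fib (n - 1)) * int (fib k)"
proof -
  obtain m where "n = Suc m" using assms not0_implies_Suc by blast
  then show ?thesis
    using arg_cong[OF fib_add[of m k], of int] by (simp add: algebra_simps)
qed

text \<open>An entry of \<open>M^(2n) = L * M^n + 1\<close>, where \<open>L\<close> is the Lucas
  number. The forward shift from \<open>k + n\<close> produces the term
  \<open>F n * F (k + n + 1)\<close>, which the backward identity with sign \<open>-1\<close>
  eliminates.\<close>

lemma fib_double_shift_odd:
  assumes "odd n"
  shows "int (fib (k + 2 * n)) = int (fib (n - 1) + fib (n + 1)) * int (fib (k + n)) + int (fib k)"
proof -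
  have "n > 0" using assms by (simp add: odd_pos)
  then show ?thesis
    using fib_backward[of n k] fib_forward[of n "k + n"] assms
    by (simp add: algebra_simps mult_2_right)
qed

text \<open>With sign \<open>+1\<close> the backward identity leaves \<open>F n\<close> as a common
  factor. The remaining combination of two neighbours is the shift form of
  \<open>2 * M - 1\<close>.\<close>

lemma fib_double_shift_even:
  assumes "even n" "n > 0"
  shows "int (fib (k + 2 * n)) =
    int (fib n) * (2 * int (fib (k + n + 1)) - int (fib (k + n))) + int (fib k)"
proof -
  obtain m where "n = Suc m" using assms not0_implies_Suc by blast
  then have "int (fib (n + 1)) = int (fib n) + int (fib (n - 1))" by simp
  then show ?thesis
    using fib_backward[of n k] fib_forward[of n "k + n"] assms
    by (simp add: algebra_simps mult_2_right)
qed

section \<open>Periodic sequences satisfying the crossing relations\<close>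

text \<open>The arcs listed in cyclic order, with the base arc sent to the identity. Multiplicative
  notation allows the values to lie in a quotient group as well as in a product of cyclic
  groups.\<close>

definition fox_sequence :: "('g, 'm) monoid_scheme \<Rightarrow> nat \<Rightarrow> (nat \<Rightarrow> 'g) \<Rightarrow> bool" where
  "fox_sequence G N x \<longleftrightarrow> x \<in> UNIV \<rightarrow> carrier G \<and> x 0 = \<one>\<^bsub>G\<^esub> \<and> (\<forall>k. x (k + N) = x k) \<and>
     (\<forall>k. x (k + 3) \<otimes>\<^bsub>G\<^esub> x k = x (k + 2) \<otimes>\<^bsub>G\<^esub> x (k + 2))"

context comm_group
begin

lemma int_pow_pair_mult:
  fixes p q r s :: int
  assumes "a \<in> carrier G" "b \<in> carrier G"
  shows "(a [^] p \<otimes> b [^] q) \<otimes> (a [^] r \<otimes> b [^] s) = a [^] (p + r) \<otimes> b [^] (q + s)"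
  using assms by (simp add: int_pow_mult m_ac)

lemma int_pow_pair_pow:
  fixes p q m :: int
  assumes "a \<in> carrier G" "b \<in> carrier G"
  shows "(a [^] p \<otimes> b [^] q) [^] m = a [^] (p * m) \<otimes> b [^] (q * m)"
  using assms by (simp add: int_pow_distrib int_pow_pow)

text \<open>Consecutive differences form a Fibonacci sequence starting with \<open>x 1\<close> and
  \<open>x 2 - x 1\<close> (written additively), and the \<open>k\<close>-th term is the sum of the
  first \<open>k\<close> of them. The \<open>- 1\<close> comes from
  \<open>F 0 + ... + F (k - 1) = F (k + 1) - 1\<close>.\<close>

lemma fox_sequence_closed_form:
  assumes x: "fox_sequence G N x"
  shows "x k = x 1 [^] int (fib k) \<otimes> (x 2 \<otimes> inv x 1) [^] (int (fib (k + 1)) - 1)"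
proof (induction k rule: less_induct)
  case (less k)
  have c [simp]: "x j \<in> carrier G" for j using x by (auto simp: fox_sequence_def)
  have "k = 0 \<or> k = 1 \<or> k = 2 \<or> k = k - 3 + 3" by linarith
  then consider "k = 0" | "k = 1" | "k = 2" | j where "k = j + 3"
    by blast
  then show ?case
  proof cases
    case 1
    then show ?thesis using x by (simp add: fox_sequence_def)
  next
    case 2
    then show ?thesis by simp
  next
    case 3
    have "fib 3 = 2" by (simp add: eval_nat_numeral)
    then show ?thesis using 3 m_lcomm[of "x 1" "x 2" "inv x 1"] by simp
  next
    case (4 j)
    define a where "a = x 1"
    define b where "b = x 2 \<otimes> inv x 1"
    have ab: "a \<in> carrier G" "b \<in> carrier G" by (auto simp: a_def b_def)
    have IH: "x i = a [^] int (fib i) \<otimes> b [^] (int (fib (i + 1)) - 1)" if "i < k" for i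
      using less.IH[OF that] unfolding a_def b_def .
    have f: "fib (j + 3) = fib (j + 2) + fib (j + 1)" "fib (j + 4) = 2 * fib (j + 2) + fib (j + 1)"
      "fib (j + 2) = fib (j + 1) + fib j"
      by (simp_all add: eval_nat_numeral)
    have idx: "j + 2 + 1 = j + 3" "j + 3 + 1 = j + 4" by simp_all
    have "x (j + 3) \<otimes> x j = x (j + 2) \<otimes> x (j + 2)" using x by (simp add: fox_sequence_def)
    \<comment> \<open>The right-hand side is brought to the form (expected value of
      \<open>x (j + 3)\<close>) times \<open>x j\<close>, so that cancelling \<open>x j\<close>
      finishes the induction.\<close>
    also have "\<dots> = (a [^] int (fib (j + 3)) \<otimes> b [^] (int (fib (j + 4)) - 1)) \<otimes> x j"
    proof -
      have "x (j + 2) = a [^] int (fib (j + 2)) \<otimes> b [^] (int (fib (j + 3)) - 1)"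
        "x j = a [^] int (fib j) \<otimes> b [^] (int (fib (j + 1)) - 1)"
        using IH[of "j + 2"] IH[of j] unfolding 4 idx by simp_all
      then show ?thesis unfolding int_pow_pair_mult[OF ab]
        using f by (simp only: int_pow_pair_mult[OF ab])
          (intro arg_cong2[where f = "\<lambda>p q :: int. a [^] (p :: int) \<otimes> b [^] q"], simp_all)
    qed
    finally show ?thesis
      using ab unfolding 4 b_def[symmetric] unfolding a_def[symmetric] idx by simp
  qed
qed


text \<open>Multiplying the closed form by \<open>b\<close> removes the \<open>- 1\<close> from the
  exponent. Periodicity thereby becomes the homogeneous condition that \<open>M^N - 1\<close>
  annihilates the pair \<open>(a, b)\<close>.\<close>

lemma fox_sequence_period:
  fixes a b
  assumes x: "fox_sequence G N x"
  defines "a \<equiv> x 1" and "b \<equiv> x 2 \<otimes> inv x 1"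
  shows "a [^] int (fib (N + k)) \<otimes> b [^] int (fib (N + k + 1)) = a [^] int (fib k) \<otimes> b [^] int (fib (k + 1))"
proof -
  have c [simp]: "x j \<in> carrier G" for j using x by (auto simp: fox_sequence_def)
  then have ab: "a \<in> carrier G" "b \<in> carrier G" by (auto simp: a_def b_def)
  have *: "a [^] int (fib j) \<otimes> b [^] int (fib (j + 1)) = x j \<otimes> b" for j
  proof -
    have "x j \<otimes> b = (a [^] int (fib j) \<otimes> b [^] (int (fib (j + 1)) - 1)) \<otimes> (a [^] (0 :: int) \<otimes> b [^] (1 :: int))"
      using fox_sequence_closed_form[OF x, of j] ab unfolding a_def b_def by simp
    then show ?thesis unfolding int_pow_pair_mult[OF ab] by simp
  qed
  have "x (N + k) = x k" using x by (metis fox_sequence_def add.commute)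
  then show ?thesis using *[of "N + k"] *[of k] by simp
qed

text \<open>Comparing the double shift with the period \<open>2 * n\<close> shows that
  \<open>l\<close> annihilates every pair shifted by \<open>n\<close>. Since the shift is
  invertible, \<open>l\<close> annihilates \<open>a\<close> and \<open>b\<close> themselves.\<close>

lemma fox_sequence_odd_order:
  assumes x: "fox_sequence G (2 * n) x" and "odd n"
  defines "l \<equiv> int (fib (n - 1) + fib (n + 1))"
  shows "x 1 [^] l = \<one>" "(x 2 \<otimes> inv x 1) [^] l = \<one>"
proof -
  define a where "a = x 1"
  define b where "b = x 2 \<otimes> inv x 1"
  have c [simp]: "x j \<in> carrier G" for j using x by (auto simp: fox_sequence_def)
  then have ab [simp]: "a \<in> carrier G" "b \<in> carrier G" by (auto simp: a_def b_def)
  define w where "w p q = a [^] p \<otimes> b [^] q" for p q :: int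
  have w [simp]: "w p q \<in> carrier G" for p q by (simp add: w_def)
  have mult: "w p q \<otimes> w r s = w (p + r) (q + s)" and pow: "w p q [^] m = w (p * m) (q * m)"
    for p q r s m unfolding w_def by (simp_all add: int_pow_pair_mult int_pow_pair_pow)
  let ?W = "\<lambda>k. w (int (fib k)) (int (fib (k + 1)))"
  have per: "?W (k + 2 * n) = ?W k" for k
    using fox_sequence_period[OF x, of k] unfolding w_def a_def b_def by (simp add: add.commute)
  have "?W (k + n) [^] l \<otimes> ?W k = ?W (k + 2 * n)" for k
    unfolding pow mult using fib_double_shift_odd[OF \<open>odd n\<close>, of k] fib_double_shift_odd[OF \<open>odd n\<close>, of "k + 1"]
    by (simp add: l_def algebra_simps)
  then have "?W (k + n) [^] l \<otimes> ?W k = ?W k" for k unfolding per .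
  then have W: "?W (k + n) [^] l = \<one>" for k by (rule r_cancel_one[THEN iffD1, rotated 2]) simp_all
  \<comment> \<open>A second shift by \<open>n\<close> completes a period, which replaces the
    inverse of \<open>M^n\<close>: the elements reached are \<open>?W 0 = b\<close> and
    \<open>?W 1 = a * b\<close>.\<close>
  have "?W (n + n) = w 0 1" "?W (n + 1 + n) = w 1 1"
    using per[of 0] per[of 1] by (simp_all add: mult_2)
  then have "w 0 1 [^] l = \<one>" "w 1 1 [^] l = \<one>" using W[of n] W[of "n + 1"] by simp_all
  then have "b [^] l = \<one>" "a [^] l \<otimes> b [^] l = \<one>"
    by (simp_all add: w_def int_pow_distrib)
  then have "a [^] l = \<one>" "b [^] l = \<one>" by simp_all
  then show "x 1 [^] l = \<one>" "(x 2 \<otimes> inv x 1) [^] l = \<one>"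
    unfolding a_def b_def .
qed

text \<open>The double shift and the period give the two relations encoded by
  \<open>F n * (2 * M - 1)\<close>. A unimodular change of these relations diagonalizes them, with
  \<open>b\<close> and \<open>a - 2 * b\<close> as the new generators.\<close>

lemma fox_sequence_even_order:
  assumes x: "fox_sequence G (2 * n) x" and n: "even n" "n > 0"
  defines "b \<equiv> x 2 \<otimes> inv x 1"
  shows "b [^] (5 * int (fib n)) = \<one>" "(x 1 \<otimes> b [^] (-2 :: int)) [^] int (fib n) = \<one>"
proof -
  define a where "a = x 1"
  let ?f = "int (fib n)"
  have c [simp]: "x j \<in> carrier G" for j using x by (auto simp: fox_sequence_def)
  then have ab [simp]: "a \<in> carrier G" "b \<in> carrier G" by (auto simp: a_def b_def)
  define w where "w p q = a [^] p \<otimes> b [^] q" for p q :: int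
  have w [simp]: "w p q \<in> carrier G" for p q by (simp add: w_def)
  have mult: "w p q \<otimes> w r s = w (p + r) (q + s)" and pow: "w p q [^] m = w (p * m) (q * m)"
    for p q r s m unfolding w_def by (simp_all add: int_pow_pair_mult int_pow_pair_pow)
  let ?W = "\<lambda>k. w (int (fib k)) (int (fib (k + 1)))"
  have per: "?W (k + 2 * n) = ?W k" for k
    using fox_sequence_period[OF x, of k] unfolding w_def a_def b_def by (simp add: add.commute)
  let ?V = "\<lambda>k. ?W (k + n + 1) [^] (2 * ?f) \<otimes> ?W (k + n) [^] (- ?f)"
  have "?V k \<otimes> ?W k = ?W (k + 2 * n)" for k
    unfolding pow mult using fib_double_shift_even[OF n, of k] fib_double_shift_even[OF n, of "k + 1"]
    by (intro arg_cong2[where f = w]) (simp_all add: algebra_simps)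
  then have "?V k \<otimes> ?W k = ?W k" for k unfolding per .
  then have V: "?V k = \<one>" for k by (rule r_cancel_one[THEN iffD1, rotated 2]) simp_all
  have "n + n = 0 + 2 * n" "n + n + 1 = 1 + 2 * n" "n + 1 + n = 1 + 2 * n" "n + 1 + n + 1 = 2 + 2 * n"
    by simp_all
  then have "?W (n + n) = ?W 0" "?W (n + n + 1) = ?W 1" "?W (n + 1 + n) = ?W 1" "?W (n + 1 + n + 1) = ?W 2"
    using per by metis+
  moreover have "fib (2 + 1) = 2" by (simp add: eval_nat_numeral)
  ultimately have "?W (n + n) = w 0 1" "?W (n + n + 1) = w 1 1" "?W (n + 1 + n) = w 1 1"
      "?W (n + 1 + n + 1) = w 1 2"
    by (simp_all only: fib0 fib_1 fib_2 add_0 one_add_one of_nat_0 of_nat_1 of_nat_numeral)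
  then have "w 1 1 [^] (2 * ?f) \<otimes> w 0 1 [^] (- ?f) = \<one>" "w 1 2 [^] (2 * ?f) \<otimes> w 1 1 [^] (- ?f) = \<one>"
    using V[of n] V[of "n + 1"] by simp_all
  then have 1: "w (2 * ?f) ?f = \<one>" and 2: "w ?f (3 * ?f) = \<one>"
    unfolding pow mult by simp_all
  \<comment> \<open>On exponent pairs, twice \<open>(f, 3f)\<close> minus \<open>(2f, f)\<close> is
    \<open>(0, 5f)\<close>. The difference \<open>(2f, f) - (f, 3f) = (f, -2f)\<close> used
    afterwards gives the second relation.\<close>
  have "w ?f (3 * ?f) [^] (2::int) \<otimes> w (2 * ?f) ?f [^] (-1::int) = \<one>"
    unfolding 1 2 by simp
  then show "b [^] (5 * ?f) = \<one>" unfolding pow mult by (simp add: w_def)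
  have "w (2 * ?f) ?f \<otimes> w ?f (3 * ?f) [^] (-1::int) = \<one>"
    unfolding 1 2 by simp
  then have "(a \<otimes> b [^] (-2::int)) [^] ?f = \<one>"
    unfolding pow mult by (simp add: w_def int_pow_distrib int_pow_pow)
  then show "(x 1 \<otimes> b [^] (-2::int)) [^] ?f = \<one>" unfolding a_def .
qed

section \<open>Products of two cyclic groups: homomorphisms, sequences, generators\<close>

lemma hom_integer_mod_pair:
  fixes a b
  assumes a: "a \<in> carrier G" "a [^] int m = \<one>" and b: "b \<in> carrier G" "b [^] int l = \<one>"
  obtains h where "h \<in> hom (integer_mod_group m \<times>\<times> integer_mod_group l) G"
    "\<And>p q :: int. h (p mod int m, q mod int l) = a [^] p \<otimes> b [^] q"
proof
  define h where "h = (\<lambda>(p :: int, q :: int). a [^] p \<otimes> b [^] q)"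
  have red: "c [^] (p mod int k) = c [^] p" if "c \<in> carrier G" "c [^] int k = \<one>" for c k and p :: int
  proof -
    have "c [^] p = c [^] (int k * (p div int k) + p mod int k)" by simp
    also have "\<dots> = (c [^] int k) [^] (p div int k) \<otimes> c [^] (p mod int k)"
      unfolding int_pow_pow[OF that(1)] by (rule int_pow_mult) (rule that)
    finally show ?thesis using that by simp
  qed
  show *: "h (p mod int m, q mod int l) = a [^] p \<otimes> b [^] q" for p q :: int
    using red[OF a] red[OF b] by (simp add: h_def)
  show "h \<in> hom (integer_mod_group m \<times>\<times> integer_mod_group l) G"
    unfolding hom_def
    using a b by (auto simp: * int_pow_pair_mult, auto simp: h_def int_pow_pair_mult)
qed

end

lemma fox_sequence_integer_mod_pair:
  fixes u v :: "nat \<Rightarrow> int"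
  assumes "m > 0" "l > 0" "u 0 = 0" "v 0 = 0"
    and "\<And>k. u (k + N) mod int m = u k mod int m" "\<And>k. v (k + N) mod int l = v k mod int l"
    and "\<And>k. u (k + 3) + u k = 2 * u (k + 2)" "\<And>k. v (k + 3) + v k = 2 * v (k + 2)"
  shows "fox_sequence (integer_mod_group m \<times>\<times> integer_mod_group l) N (\<lambda>k. (u k mod int m, v k mod int l))"
  using assms unfolding fox_sequence_def
  by (auto simp: carrier_integer_mod_group mod_add_eq mod_mult_right_eq)

lemma integer_mod_pair_generate:
  fixes p q r s :: int
  assumes ml: "m > 0" "l > 0"
    and det: "p * s - q * r = 1"
    and g: "(p mod int m, r mod int l) \<in> S" "(q mod int m, s mod int l) \<in> S"
    and S: "S \<subseteq> carrier (integer_mod_group m \<times>\<times> integer_mod_group l)"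
  shows "generate (integer_mod_group m \<times>\<times> integer_mod_group l) S = carrier (integer_mod_group m \<times>\<times> integer_mod_group l)"
    (is "generate ?G S = _")
proof
  interpret G: group ?G by (intro DirProd_group) simp_all
  show "generate ?G S \<subseteq> carrier ?G" by (rule G.generate_incl[OF S])
  have sub: "subgroup (generate ?G S) ?G" by (rule G.generate_is_subgroup[OF S])
  have hom: "fst \<in> hom ?G (integer_mod_group m)" "snd \<in> hom ?G (integer_mod_group l)"
    by (auto simp: hom_def)
  have pow: "z [^]\<^bsub>?G\<^esub> k = (fst z * k mod int m, snd z * k mod int l)"
    if "z \<in> carrier ?G" for z and k :: int
    using hom_int_pow[OF hom(1) that] hom_int_pow[OF hom(2) that]
    by (simp add: prod_eq_iff int_pow_integer_mod_group mult.commute G.is_group)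
  show "carrier ?G \<subseteq> generate ?G S"
  proof
    fix z assume z: "z \<in> carrier ?G"
    let ?p = "(p mod int m, r mod int l)" and ?q = "(q mod int m, s mod int l)"
    \<comment> \<open>Cramer's rule: these are the coefficients of \<open>z\<close> with respect to
      the columns \<open>(p, r)\<close> and \<open>(q, s)\<close>, whose determinant is 1.\<close>
    let ?i = "s * fst z - q * snd z" and ?j = "p * snd z - r * fst z"
    have "?p [^]\<^bsub>?G\<^esub> ?i \<otimes>\<^bsub>?G\<^esub> ?q [^]\<^bsub>?G\<^esub> ?j \<in> generate ?G S"
      using sub g by (intro subgroup.m_closed[OF sub] G.subgroup_int_pow_closed[OF sub] generate.incl)
    also have "?p [^]\<^bsub>?G\<^esub> ?i \<otimes>\<^bsub>?G\<^esub> ?q [^]\<^bsub>?G\<^esub> ?j =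
        ((p * ?i + q * ?j) mod int m, (r * ?i + s * ?j) mod int l)"
      using g S by (subst (1 2) pow) (auto simp: mod_simps)
    also have "\<dots> = ((p * s - q * r) * fst z mod int m, (p * s - q * r) * snd z mod int l)"
      by (simp add: algebra_simps)
    also have "\<dots> = z"
      using z ml unfolding det by (auto simp: carrier_integer_mod_group)
    finally show "z \<in> generate ?G S" .
  qed
qed

section \<open>Universal sequences for odd and even \<open>n\<close>\<close>

text \<open>The witness is the closed form with the two coordinate generators in the roles of
  \<open>a\<close> and \<open>b\<close>. Any other sequence has \<open>a\<close> and
  \<open>b\<close> annihilated by \<open>l\<close>, so sending the generators there is well defined,
  and the closed form makes the two sequences agree at every index.\<close>

lemma universal_fox_sequence_odd:
  assumes "odd n"
  defines "l \<equiv> fib (n - 1) + fib (n + 1)"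
  obtains g where "fox_sequence (integer_mod_group l \<times>\<times> integer_mod_group l) (2 * n) g"
    "generate (integer_mod_group l \<times>\<times> integer_mod_group l) (range g) =
       carrier (integer_mod_group l \<times>\<times> integer_mod_group l)"
    "\<And>A x. \<lbrakk>comm_group A; fox_sequence A (2 * n) x\<rbrakk> \<Longrightarrow>
       \<exists>h\<in>hom (integer_mod_group l \<times>\<times> integer_mod_group l) A. \<forall>k. h (g k) = x k"
proof
  let ?G = "integer_mod_group l \<times>\<times> integer_mod_group l"
  define g where "g k = (int (fib k) mod int l, (int (fib (k + 1)) - 1) mod int l)" for k
  have "n > 0" using assms by (simp add: odd_pos)
  then have l: "l > 0" using fib_neq_0_nat[of "n + 1"] by (simp add: l_def)
  have per: "int (fib (k + 2 * n)) mod int l = int (fib k) mod int l" for k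
    unfolding fib_double_shift_odd[OF \<open>odd n\<close>] l_def by simp
  show fox: "fox_sequence ?G (2 * n) g"
    unfolding g_def
  proof (rule fox_sequence_integer_mod_pair[OF l l])
    show "(int (fib (k + 2 * n + 1)) - 1) mod int l = (int (fib (k + 1)) - 1) mod int l" for k
      using per[of "k + 1"] mod_diff_cong by fastforce
  qed (use per in \<open>simp_all add: eval_nat_numeral\<close>)
  \<comment> \<open>The generators used are \<open>g 1 = (1, 0)\<close> and
    \<open>g 2 = (1, 1)\<close>, of determinant 1.\<close>
  show "generate ?G (range g) = carrier ?G"
  proof (rule integer_mod_pair_generate[OF l l, where p = 1 and r = 0 and q = 1 and s = 1])
    show "(1 mod int l, 0 mod int l) \<in> range g" "(1 mod int l, 1 mod int l) \<in> range g"
      by (rule range_eqI[of _ _ 1], simp add: g_def numeral_2_eq_2)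
        (rule range_eqI[of _ _ 2], simp add: g_def eval_nat_numeral)
  qed (use fox in \<open>simp_all add: fox_sequence_def image_subset_iff_funcset\<close>)
  fix A :: "('g, 'm) monoid_scheme" and x
  assume "comm_group A" and x: "fox_sequence A (2 * n) x"
  then interpret comm_group A by simp
  have c: "x j \<in> carrier A" for j using x by (auto simp: fox_sequence_def)
  obtain h where h: "h \<in> hom ?G A"
    "\<And>p q :: int. h (p mod int l, q mod int l) = x 1 [^]\<^bsub>A\<^esub> p \<otimes>\<^bsub>A\<^esub> (x 2 \<otimes>\<^bsub>A\<^esub> inv\<^bsub>A\<^esub> x 1) [^]\<^bsub>A\<^esub> q"
  proof (rule hom_integer_mod_pair[of "x 1" l "x 2 \<otimes>\<^bsub>A\<^esub> inv\<^bsub>A\<^esub> x 1" l])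
    show "x 1 [^]\<^bsub>A\<^esub> int l = \<one>\<^bsub>A\<^esub>" "(x 2 \<otimes>\<^bsub>A\<^esub> inv\<^bsub>A\<^esub> x 1) [^]\<^bsub>A\<^esub> int l = \<one>\<^bsub>A\<^esub>"
      using fox_sequence_odd_order[OF x \<open>odd n\<close>] by (simp_all add: l_def)
  qed (use c in auto)
  have "h (g k) = x k" for k
    unfolding g_def h(2) by (rule fox_sequence_closed_form[OF x, symmetric])
  then show "\<exists>h\<in>hom ?G A. \<forall>k. h (g k) = x k" using h(1) by blast
qed

text \<open>
  With \<open>c = a - 2 * b\<close> the relations for even \<open>n\<close> become \<open>5 * F n * b = 0\<close>
  and \<open>F n * c = 0\<close>. Writing \<open>a\<close> as \<open>c + 2 * b\<close> in the closed form
  \<open>x k = F k * a + (F (k + 1) - 1) * b\<close> gives the witness below.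
\<close>

lemma universal_fox_sequence_even:
  assumes n: "even n" "n > 0"
  defines "f \<equiv> fib n"
  obtains g where "fox_sequence (integer_mod_group (5 * f) \<times>\<times> integer_mod_group f) (2 * n) g"
    "generate (integer_mod_group (5 * f) \<times>\<times> integer_mod_group f) (range g) =
       carrier (integer_mod_group (5 * f) \<times>\<times> integer_mod_group f)"
    "\<And>A x. \<lbrakk>comm_group A; fox_sequence A (2 * n) x\<rbrakk> \<Longrightarrow>
       \<exists>h\<in>hom (integer_mod_group (5 * f) \<times>\<times> integer_mod_group f) A. \<forall>k. h (g k) = x k"
proof
  let ?G = "integer_mod_group (5 * f) \<times>\<times> integer_mod_group f"
  define u where "u k = 2 * int (fib k) + int (fib (k + 1)) - 1" for k
  define g where "g k = (u k mod int (5 * f), int (fib k) mod int f)" for k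
  have f: "f > 0" "5 * f > 0" using fib_neq_0_nat n(2) by (simp_all add: f_def)
  show fox: "fox_sequence ?G (2 * n) g"
    unfolding g_def
  proof (rule fox_sequence_integer_mod_pair[OF f(2,1)])
    fix k
    \<comment> \<open>Source of the factor 5: with \<open>A = F (k + n + 1)\<close> and
      \<open>B = F (k + n)\<close>, the increment of \<open>u\<close> is \<open>F n\<close> times
      \<open>2 * (2 * A - B) + (2 * (A + B) - A) = 5 * A\<close>.\<close>
    have "u (k + 2 * n) = u k + int (5 * f) * int (fib (k + n + 1))"
      using fib_double_shift_even[OF n, of k] fib_double_shift_even[OF n, of "k + 1"]
      by (simp add: u_def f_def algebra_simps)
    then show "u (k + 2 * n) mod int (5 * f) = u k mod int (5 * f)" by simp
    show "int (fib (k + 2 * n)) mod int f = int (fib k) mod int f"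
      unfolding fib_double_shift_even[OF n] f_def by simp
  qed (simp_all add: u_def eval_nat_numeral)
  \<comment> \<open>Here \<open>g 2 = (3, 1)\<close> and \<open>g 1 = (2, 1)\<close> form the basis
    of determinant 1.\<close>
  show "generate ?G (range g) = carrier ?G"
  proof (rule integer_mod_pair_generate[OF f(2,1), where p = 3 and r = 1 and q = 2 and s = 1])
    show "(3 mod int (5 * f), 1 mod int f) \<in> range g" "(2 mod int (5 * f), 1 mod int f) \<in> range g"
      by (rule range_eqI[of _ _ 2], simp add: g_def u_def eval_nat_numeral)
        (rule range_eqI[of _ _ 1], simp add: g_def u_def eval_nat_numeral)
  qed (use fox in \<open>simp_all add: fox_sequence_def image_subset_iff_funcset\<close>)
  fix A :: "('g, 'm) monoid_scheme" and x
  assume "comm_group A" and x: "fox_sequence A (2 * n) x"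
  then interpret comm_group A by simp
  have c [simp]: "x j \<in> carrier A" for j using x by (auto simp: fox_sequence_def)
  define b where "b = x 2 \<otimes>\<^bsub>A\<^esub> inv\<^bsub>A\<^esub> x 1"
  define c where "c = x 1 \<otimes>\<^bsub>A\<^esub> b [^]\<^bsub>A\<^esub> (- 2 :: int)"
  have bc: "b \<in> carrier A" "c \<in> carrier A" by (auto simp: b_def c_def)
  obtain h where h: "h \<in> hom ?G A"
    "\<And>p q :: int. h (p mod int (5 * f), q mod int f) = b [^]\<^bsub>A\<^esub> p \<otimes>\<^bsub>A\<^esub> c [^]\<^bsub>A\<^esub> q"
  proof (rule hom_integer_mod_pair[of b "5 * f" c f])
    show "b [^]\<^bsub>A\<^esub> int (5 * f) = \<one>\<^bsub>A\<^esub>" "c [^]\<^bsub>A\<^esub> int f = \<one>\<^bsub>A\<^esub>"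
      using fox_sequence_even_order[OF x n] by (simp_all add: b_def c_def f_def)
  qed (use bc in auto)
  have "h (g k) = x k" for k
  proof -
    have "h (g k) = x 1 [^]\<^bsub>A\<^esub> int (fib k) \<otimes>\<^bsub>A\<^esub> b [^]\<^bsub>A\<^esub> (u k + - 2 * int (fib k))"
      using bc(1) unfolding g_def h(2) c_def
      by (subst int_pow_mult) (simp_all add: int_pow_distrib int_pow_pow m_ac)
    then show ?thesis
      using fox_sequence_closed_form[OF x, of k] by (simp add: u_def b_def)
  qed
  then show "\<exists>h\<in>hom ?G A. \<forall>k. h (g k) = x k" using h(1) by blast
qed

section \<open>Diagrams whose arcs are indexed by residues\<close>

text \<open>Labels are integers compared modulo \<open>N\<close>, so that arcs become residues. The
  overarc \<open>j\<close> has underarcs \<open>j + 1\<close> and \<open>j - 2\<close>, in either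
  order; with \<open>k = j - 2\<close> this is the recurrence of \<open>fox_sequence\<close>. By
  \<open>crossing_exists\<close> every residue labels an overarc, so each instance of the recurrence
  is imposed.\<close>

locale cyclic_diagram =
  fixes D :: "('s, 'c) link_diagram" and N :: nat and label :: "'s \<Rightarrow> int"
  assumes N_pos: "N > 0"
    and label_continues: "(s, t) \<in> continues D \<Longrightarrow> label s mod int N = label t mod int N"
    and label_connected: "\<lbrakk>s \<in> segments D; t \<in> segments D; label s mod int N = label t mod int N\<rbrakk>
      \<Longrightarrow> (s, t) \<in> arc_rel D"
    and crossing_segments: "c \<in> crossings D \<Longrightarrow>
      {fst (over D c), fst (under D c), snd (under D c)} \<subseteq> segments D"
    and crossing_labels: "c \<in> crossings D \<Longrightarrow> j = label (fst (over D c)) \<Longrightarrow>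
      (label (fst (under D c)) mod int N = (j + 1) mod int N \<and>
       label (snd (under D c)) mod int N = (j - 2) mod int N) \<or>
      (label (fst (under D c)) mod int N = (j - 2) mod int N \<and>
       label (snd (under D c)) mod int N = (j + 1) mod int N)"
    and crossing_exists: "\<exists>c\<in>crossings D. label (fst (over D c)) mod int N = j mod int N"
begin

definition arc :: "int \<Rightarrow> 's set" where
  "arc j = {t \<in> segments D. label t mod int N = j mod int N}"

lemma arc_rel_imp_label: "(s, t) \<in> arc_rel D \<Longrightarrow> label s mod int N = label t mod int N"
proof -
  assume "(s, t) \<in> arc_rel D"
  then have "(s, t) \<in> (continues D \<union> (continues D)\<inverse>)\<^sup>*" by (simp add: arc_rel_def)
  then show ?thesis by (induction rule: rtrancl_induct) (auto dest: label_continues)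
qed

lemma arc_of_eq: "s \<in> segments D \<Longrightarrow> arc_of D s = arc (label s)"
proof -
  assume s: "s \<in> segments D"
  have "(s, t) \<in> arc_rel D \<longleftrightarrow> t \<in> segments D \<and> label t mod int N = label s mod int N" for t
  proof
    show "(s, t) \<in> arc_rel D \<Longrightarrow> t \<in> segments D \<and> label t mod int N = label s mod int N"
      using arc_rel_imp_label[of s t] by (simp add: arc_rel_def)
  qed (use label_connected[OF s] in auto)
  then show ?thesis by (auto simp: arc_of_def arc_def)
qed

lemma arc_cong: "i mod int N = j mod int N \<Longrightarrow> arc i = arc j"
  by (simp add: arc_def)

lemma segment_exists: "\<exists>s\<in>segments D. label s mod int N = j mod int N"
  using crossing_exists[of j] crossing_segments by blast

lemma arc_eq_iff: "arc i = arc j \<longleftrightarrow> i mod int N = j mod int N"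
  using segment_exists[of i] by (auto simp: arc_def)

lemma arcs_eq: "arcs D = range arc"
proof
  show "arcs D \<subseteq> range arc"
    using arc_of_eq by (auto simp: arcs_def quotient_def arc_of_def)
  show "range arc \<subseteq> arcs D"
  proof clarify
    fix j
    obtain s where s: "s \<in> segments D" "label s mod int N = j mod int N" using segment_exists by blast
    then have "arc j = arc_of D s" using arc_of_eq by (simp add: arc_eq_iff)
    then show "arc j \<in> arcs D" using s(1) by (simp add: arcs_def arc_of_def quotientI)
  qed
qed

text \<open>A relator is symmetric in its underarcs and depends only on the residue of the label of
  its overarc. Repeated crossings and congruent indices therefore give the same relator.\<close>

lemma crossing_relators:
  "crossing_relator D ` crossings D =
   range (\<lambda>j. frag_cmul 2 (frag_of (arc j)) - frag_of (arc (j + 1)) - frag_of (arc (j - 2)))"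
    (is "_ = range ?r")
proof -
  have r: "crossing_relator D c = ?r (label (fst (over D c)))" if "c \<in> crossings D" for c
    using crossing_labels[OF that refl] crossing_segments[OF that]
    by (auto simp: crossing_relator_def arc_of_eq dest!: arc_cong)
  have cong: "?r i = ?r j" if "i mod int N = j mod int N" for i j
    using arc_cong[OF that] arc_cong[OF mod_add_cong[OF that refl], of 1]
      arc_cong[OF mod_diff_cong[OF that refl], of 2] by simp
  have "?r j \<in> crossing_relator D ` crossings D" for j
  proof -
    obtain c where c: "c \<in> crossings D" "label (fst (over D c)) mod int N = j mod int N"
      using crossing_exists by blast
    show ?thesis unfolding cong[OF c(2), symmetric] r[OF c(1), symmetric] using c(1) by (rule imageI)
  qed
  moreover have "crossing_relator D c \<in> range ?r" if "c \<in> crossings D" for c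
    unfolding r[OF that] by (rule rangeI)
  ultimately show ?thesis by blast
qed

text \<open>The reduced group with its list of arcs is itself universal among such sequences, hence
  isomorphic to \<open>G\<close>. The hypothesis \<open>univ\<close> is applied to
  \<open>Col_red D a\<close>, which fixes the type of \<open>A\<close>.\<close>

lemma has_Col_redI:
  fixes G :: "('g, 'm) monoid_scheme"
  assumes G: "comm_group G" and g: "fox_sequence G N g"
    and gen: "generate G (range g) = carrier G"
    and univ: "\<And>(A :: ('s set \<Rightarrow>\<^sub>0 int) set set monoid) x.
      \<lbrakk>comm_group A; fox_sequence A N x\<rbrakk> \<Longrightarrow> \<exists>h\<in>hom G A. \<forall>k. h (g k) = x k"
  shows "has_Col_red D G"
  unfolding has_Col_red_def
proof (intro conjI ballI)
  show "arcs D \<noteq> {}" by (simp add: arcs_eq)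
  fix a assume "a \<in> arcs D"
  then obtain j0 where a: "a = arc j0" by (auto simp: arcs_eq)
  let ?F = "free_Abelian_group (arcs D)" and ?R = "coloring_relations D" and ?C = "Col D"
  let ?T = "generate ?C {col_class D (frag_of a)}" and ?A = "Col_red D a"
  let ?r = "\<lambda>j. frag_cmul 2 (frag_of (arc j)) - frag_of (arc (j + 1)) - frag_of (arc (j - 2))"
  interpret G: comm_group G by (rule G)
  interpret F: comm_group ?F by (rule abelian_free_Abelian_group)
  have e: "frag_of (arc j) \<in> carrier ?F" for j by (simp add: arcs_eq)
  have r_eq: "?r j = frag_of (arc j) \<otimes>\<^bsub>?F\<^esub> frag_of (arc j) \<otimes>\<^bsub>?F\<^esub>
      inv\<^bsub>?F\<^esub> (frag_of (arc (j + 1))) \<otimes>\<^bsub>?F\<^esub> inv\<^bsub>?F\<^esub> (frag_of (arc (j - 2)))" for j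
    using e[of "j + 1"] e[of "j - 2"] by (simp add: frag_cmul_distrib[of 1 1, simplified])
  have r_in: "?r j \<in> carrier ?F" for j
    unfolding r_eq by (intro F.m_closed F.inv_closed e)
  have R: "?R = generate ?F (range ?r)"
    by (simp only: coloring_relations_def crossing_relators)
  have R_sub: "subgroup ?R ?F" unfolding R using r_in by (intro F.generate_is_subgroup) auto
  have R_norm: "?R \<lhd> ?F" by (rule F.subgroup_imp_normal[OF R_sub])
  interpret C: comm_group ?C unfolding Col_def by (rule F.abelian_FactGroup[OF R_sub])
  have cls_hom: "col_class D \<in> hom ?F ?C"
    unfolding col_class_def Col_def by (rule normal.r_coset_hom_Mod[OF R_norm])
  interpret cls: group_hom ?F ?C "col_class D"
    using cls_hom by (simp add: group_hom_def group_hom_axioms_def)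
  have a_in: "col_class D (frag_of a) \<in> carrier ?C" unfolding a using e by simp
  have T_sub: "subgroup ?T ?C" using a_in by (intro C.generate_is_subgroup) auto
  have T_norm: "?T \<lhd> ?C" by (rule C.subgroup_imp_normal[OF T_sub])
  interpret A: comm_group ?A unfolding Col_red_def by (rule C.abelian_FactGroup[OF T_sub])
  define p where "p x = ?T #>\<^bsub>?C\<^esub> col_class D x" for x
  have p_hom: "p \<in> hom ?F ?A"
    using hom_compose[OF cls_hom normal.r_coset_hom_Mod[OF T_norm]]
    by (simp add: p_def[abs_def] o_def Col_red_def)
  interpret p: group_hom ?F ?A p
    using p_hom by (simp add: group_hom_def group_hom_axioms_def)
  have p_surj: "\<exists>x\<in>carrier ?F. y = p x" if "y \<in> carrier ?A" for y
    using that by (auto simp: Col_red_def Col_def FactGroup_def RCOSETS_def p_def col_class_def)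
  have p_r: "p (?r j) = \<one>\<^bsub>?A\<^esub>" for j
  proof -
    have "?r j \<in> ?R" unfolding R by (rule generate.incl) auto
    then have "col_class D (?r j) = \<one>\<^bsub>?C\<^esub>"
      using F.coset_join2[OF r_in R_sub] by (simp add: col_class_def Col_def FactGroup_def)
    then show ?thesis
      using C.coset_join2[OF C.one_closed T_sub] subgroup.one_closed[OF T_sub]
      by (simp add: p_def Col_red_def FactGroup_def)
  qed
  have p_a: "p (frag_of a) = \<one>\<^bsub>?A\<^esub>"
    using C.coset_join2[OF a_in T_sub] by (simp add: p_def Col_red_def FactGroup_def generate.incl)

  \<comment> \<open>The arcs are read off starting from the chosen arc \<open>a = arc j0\<close>, so
    that it takes index 0; this treats all choices of \<open>a\<close> alike.\<close>
  define x where "x k = p (frag_of (arc (j0 + int k)))" for k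
  have fox: "fox_sequence ?A N x"
    unfolding fox_sequence_def
  proof (intro conjI allI)
    show "x \<in> UNIV \<rightarrow> carrier ?A" using e by (auto simp: x_def)
    show "x 0 = \<one>\<^bsub>?A\<^esub>" using p_a by (simp add: x_def a)
    show "x (k + N) = x k" for k
      unfolding x_def using arc_cong[of "j0 + int (k + N)" "j0 + int k"] by (simp flip: add.assoc)
    fix k
    let ?u = "frag_of (arc (j0 + int k + 2))" and ?v = "frag_of (arc (j0 + int (k + 3)))"
      and ?w = "frag_of (arc (j0 + int k))"
    have "?u + ?u = ?r (j0 + int k + 2) + (?v + ?w)"
      by (simp add: frag_cmul_distrib[of 1 1, simplified] algebra_simps)
    then have "p (?u \<otimes>\<^bsub>?F\<^esub> ?u) = p (?r (j0 + int k + 2) \<otimes>\<^bsub>?F\<^esub> (?v \<otimes>\<^bsub>?F\<^esub> ?w))" by simp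
    also have "\<dots> = p ?v \<otimes>\<^bsub>?A\<^esub> p ?w"
      using e r_in F.m_closed[OF e e] by (simp only: p.hom_mult p_r p.hom_closed A.l_one A.m_closed)
    also have "p (?u \<otimes>\<^bsub>?F\<^esub> ?u) = p ?u \<otimes>\<^bsub>?A\<^esub> p ?u" by (rule p.hom_mult[OF e e])
    finally show "x (k + 3) \<otimes>\<^bsub>?A\<^esub> x k = x (k + 2) \<otimes>\<^bsub>?A\<^esub> x (k + 2)"
      by (simp add: x_def add.assoc add.commute[of 2])
  qed
  obtain q where q: "q \<in> hom G ?A" and q_g: "\<And>k. q (g k) = x k"
    using univ[OF A.comm_group_axioms fox] by blast
  interpret q: group_hom G ?A q
    using q by (simp add: group_hom_def group_hom_axioms_def)

  have g_per: "g (k + N * m) = g k" for k m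
  proof (induction m)
    case (Suc m)
    have "g (k + N * Suc m) = g (k + N * m + N)" by (simp add: algebra_simps)
    then show ?case using g Suc by (simp add: fox_sequence_def)
  qed simp
  have g_in: "g k \<in> carrier G" for k using g by (auto simp: fox_sequence_def)
  \<comment> \<open>In the opposite direction, \<open>c\<close> extends \<open>g\<close>
    periodically to integer indices, moved so that \<open>j0\<close> receives
    \<open>g 0\<close>.\<close>
  define c where "c i = g (nat ((i - j0) mod int N))" for i
  have c_eq: "c i = g k" if "i mod int N = (j0 + int k) mod int N" for i k
  proof -
    have "(i - j0) mod int N = int k mod int N"
      using mod_diff_cong[OF that refl, of j0] by simp
    then have "c i = g (k mod N)" by (simp add: c_def nat_mod_distrib)
    also have "\<dots> = g k" using g_per[of "k mod N" "k div N"] by simp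
    finally show ?thesis .
  qed
  have c_cong: "c i = c j" if "i mod int N = j mod int N" for i j
    using mod_diff_cong[OF that refl, of j0] by (simp add: c_def)
  define idx where "idx i = nat ((i - j0) mod int N)" for i
  have idx: "i mod int N = (j0 + int (idx i)) mod int N" for i
    using N_pos by (simp add: idx_def mod_simps)
  \<comment> \<open>An arc is a set of segments, so an index for it has to be chosen; by
    \<open>c_cong\<close> the value does not depend on the choice.\<close>
  obtain h where h: "h \<in> hom ?F G"
    and h_arc: "\<And>b. b \<in> arcs D \<Longrightarrow> h (frag_of b) = c (SOME i. b = arc i)"
    by (rule G.free_Abelian_group_universal[of "\<lambda>b. c (SOME i. b = arc i)" "arcs D"])
      (use g_in in \<open>auto simp: c_def\<close>)
  have h_c: "h (frag_of (arc i)) = c i" for i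
  proof -
    have "arc i = arc (SOME j. arc i = arc j)" by (rule someI) (rule refl)
    then show ?thesis using h_arc[of "arc i"] c_cong[of "SOME j. arc i = arc j" i]
      unfolding arc_eq_iff by (simp add: arcs_eq)
  qed
  interpret h: group_hom ?F G h
    using h by (simp add: group_hom_def group_hom_axioms_def)
  have h_r: "h (?r j) = \<one>\<^bsub>G\<^esub>" for j
  proof -
    \<comment> \<open>The recurrence starts at the lowest of its indices, \<open>j - 2\<close>; the
      overarc \<open>j\<close> and the other underarc \<open>j + 1\<close> then sit at
      \<open>k + 2\<close> and \<open>k + 3\<close>.\<close>
    define k where "k = idx (j - 2)"
    have k: "(j - 2) mod int N = (j0 + int k) mod int N" unfolding k_def by (rule idx)
    have "j mod int N = (j0 + int (k + 2)) mod int N" "(j + 1) mod int N = (j0 + int (k + 3)) mod int N"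
      using mod_add_cong[OF k refl, of 2] mod_add_cong[OF k refl, of 3] by (simp_all add: ac_simps)
    then have "c (j - 2) = g k" "c j = g (k + 2)" "c (j + 1) = g (k + 3)"
      using k by (simp_all only: c_eq)
    moreover have "g (k + 3) \<otimes>\<^bsub>G\<^esub> g k = g (k + 2) \<otimes>\<^bsub>G\<^esub> g (k + 2)"
      using g unfolding fox_sequence_def by blast
    moreover have "h (?r j) = c j \<otimes>\<^bsub>G\<^esub> c j \<otimes>\<^bsub>G\<^esub> inv\<^bsub>G\<^esub> c (j + 1) \<otimes>\<^bsub>G\<^esub> inv\<^bsub>G\<^esub> c (j - 2)"
      unfolding r_eq by (simp only: h.hom_mult h.hom_inv e F.m_closed F.inv_closed h_c)
    ultimately have "h (?r j) = g (k + 3) \<otimes>\<^bsub>G\<^esub> g k \<otimes>\<^bsub>G\<^esub> inv\<^bsub>G\<^esub> g (k + 3) \<otimes>\<^bsub>G\<^esub> inv\<^bsub>G\<^esub> g k"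
      by (simp only:)
    also have "\<dots> = (g (k + 3) \<otimes>\<^bsub>G\<^esub> g k) \<otimes>\<^bsub>G\<^esub> inv\<^bsub>G\<^esub> (g (k + 3) \<otimes>\<^bsub>G\<^esub> g k)"
      using g_in by (simp only: G.inv_mult G.m_assoc G.m_closed G.inv_closed)
    also have "\<dots> = \<one>\<^bsub>G\<^esub>" using g_in by (simp only: G.r_inv G.m_closed)
    finally show ?thesis .
  qed
  have "?R \<subseteq> kernel ?F G h"
    unfolding R using r_in h_r
    by (intro F.generate_subgroup_incl h.subgroup_kernel) (auto simp: kernel_def simp del: carrier_free_Abelian_group_iff)
  then obtain h1 where h1: "h1 \<in> hom ?C G" and h1_cls: "\<And>x. x \<in> carrier ?F \<Longrightarrow> h1 (col_class D x) = h x"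
    using h.FactGroup_universal_kernel[OF R_norm] unfolding Col_def col_class_def by metis
  interpret h1: group_hom ?C G h1
    using h1 by (simp add: group_hom_def group_hom_axioms_def)
  have "h1 (col_class D (frag_of a)) = \<one>\<^bsub>G\<^esub>"
    using h1_cls[OF e] h_c[of j0] c_eq[of j0 0] g by (simp add: a fox_sequence_def)
  then have "?T \<subseteq> kernel ?C G h1"
    using a_in by (intro C.generate_subgroup_incl h1.subgroup_kernel) (auto simp: kernel_def)
  then obtain h2 where h2: "h2 \<in> hom ?A G"
    and h2_T: "\<And>y. y \<in> carrier ?C \<Longrightarrow> h2 (?T #>\<^bsub>?C\<^esub> y) = h1 y"
    using h1.FactGroup_universal_kernel[OF T_norm] unfolding Col_red_def by metis
  have h2_p: "h2 (p y) = h y" if "y \<in> carrier ?F" for y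
    using h2_T[OF cls.hom_closed[OF that]] h1_cls[OF that] by (simp add: p_def)
  interpret h2: group_hom ?A G h2
    using h2 by (simp add: group_hom_def group_hom_axioms_def)

  \<comment> \<open>On the generators of the free group, \<open>q\<close> after \<open>h\<close>
    agrees with the projection \<open>p\<close>. Hence \<open>q\<close> is a left inverse of
    \<open>h2\<close>, which gives injectivity.\<close>
  have q_h: "q (h y) = p y" if "y \<in> carrier ?F" for y
  proof -
    show ?thesis
    proof (rule free_Abelian_group_induct[of y "arcs D" "\<lambda>y. q (h y) = p y"])
      show "Poly_Mapping.keys y \<subseteq> arcs D" using that by simp
      show "q (h 0) = p 0" using h.hom_one q.hom_one p.hom_one by simp
    next
      fix y z assume *: "Poly_Mapping.keys y \<subseteq> arcs D" "Poly_Mapping.keys z \<subseteq> arcs D"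
        "q (h y) = p y" "q (h z) = p z"
      then have yz: "y \<in> carrier ?F" "z \<in> carrier ?F" by simp_all
      have "y - z = y \<otimes>\<^bsub>?F\<^esub> inv\<^bsub>?F\<^esub> z" using * by simp
      then show "q (h (y - z)) = p (y - z)"
        using *(3,4) yz by (simp only: h.hom_mult h.hom_inv p.hom_mult p.hom_inv q.hom_mult q.hom_inv
            h.hom_closed F.inv_closed G.inv_closed)
    next
      fix b assume "b \<in> arcs D"
      then obtain i where b: "b = arc i" by (auto simp: arcs_eq)
      have "q (h (frag_of b)) = x (idx i)" unfolding b h_c c_eq[OF idx] by (rule q_g)
      also have "\<dots> = p (frag_of b)" unfolding x_def b arc_cong[OF idx[of i]] ..
      finally show "q (h (frag_of b)) = p (frag_of b)" .
    qed
  qed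
  have "inj_on h2 (carrier ?A)"
  proof (rule inj_onI)
    fix y z assume "y \<in> carrier ?A" "z \<in> carrier ?A" "h2 y = h2 z"
    then show "y = z" using p_surj h2_p q_h by metis
  qed
  moreover have "h2 ` carrier ?A = carrier G"
  proof
    show "h2 ` carrier ?A \<subseteq> carrier G" by auto
    \<comment> \<open>Surjectivity: the image of \<open>h2\<close> is a subgroup containing the
      generating sequence \<open>g\<close>.\<close>
    have "g k \<in> h2 ` carrier ?A" for k
    proof
      show "g k = h2 (x k)" unfolding x_def h2_p[OF e] h_c by (rule c_eq[symmetric]) (rule refl)
      show "x k \<in> carrier ?A" unfolding x_def by (rule p.hom_closed[OF e])
    qed
    then show "carrier G \<subseteq> h2 ` carrier ?A"
      unfolding gen[symmetric] by (intro G.generate_subgroup_incl h2.img_is_subgroup) auto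
  qed
  ultimately have "h2 \<in> iso ?A G" using h2 by (simp add: iso_def bij_betw_def)
  then show "?A \<cong> G" by (auto simp: is_iso_def)
qed

end

section \<open>The reduced group of a cyclic diagram with \<open>2 * n\<close> arcs\<close>

lemma cyclic_diagram_Col_red:
  assumes D: "cyclic_diagram D (2 * n) label"
  shows "odd n \<Longrightarrow> has_Col_red D
      (integer_mod_group (fib (n - 1) + fib (n + 1)) \<times>\<times> integer_mod_group (fib (n - 1) + fib (n + 1)))"
    and "even n \<Longrightarrow> has_Col_red D (integer_mod_group (5 * fib n) \<times>\<times> integer_mod_group (fib n))"
proof -
  have comm: "comm_group (integer_mod_group m \<times>\<times> integer_mod_group l)" for m l
    by (intro group.group_comm_groupI DirProd_group) (auto simp: add.commute)
  have "n > 0" using cyclic_diagram.N_pos[OF D] by simp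
  show "has_Col_red D (integer_mod_group (fib (n - 1) + fib (n + 1)) \<times>\<times>
      integer_mod_group (fib (n - 1) + fib (n + 1)))" if "odd n"
    by (rule universal_fox_sequence_odd[OF that], rule cyclic_diagram.has_Col_redI[OF D comm])
  show "has_Col_red D (integer_mod_group (5 * fib n) \<times>\<times> integer_mod_group (fib n))" if "even n"
    by (rule universal_fox_sequence_even[OF that \<open>n > 0\<close>], rule cyclic_diagram.has_Col_redI[OF D comm])
qed

section \<open>The wheel graph and the closed braid\<close>

text \<open>
  Labels decrease along the diagram because the crossing relations give a Fibonacci recurrence
  for the differences only when read backwards.
\<close>

fun wheel_label :: "wheel_edge \<times> bool \<Rightarrow> int" where
  "wheel_label (Spoke i, _) = - 2 * int i"
| "wheel_label (Rim i, _) = - 1 - 2 * int i"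

text \<open>Spoke and rim indices wrap modulo \<open>n\<close> and labels modulo
  \<open>2 * n\<close>; doubling makes the two reductions compatible.\<close>

lemma double_mod: "(c - 2 * int (k mod n)) mod int (2 * n) = (c - 2 * int k) mod int (2 * n)"
proof -
  have "int (k mod n) = int k - int n * int (k div n)"
    by (metis minus_mult_div_eq_mod of_nat_div of_nat_mod)
  then have "c - 2 * int (k mod n) = (c - 2 * int k) + int (2 * n) * int (k div n)"
    by (simp add: algebra_simps)
  then show ?thesis by (simp only: mod_mult_self2)
qed

lemma wheel_label_mod:
  "wheel_label (Spoke (k mod n), b) mod int (2 * n) = (- 2 * int k) mod int (2 * n)"
  "wheel_label (Rim (k mod n), b) mod int (2 * n) = (- 1 - 2 * int k) mod int (2 * n)"
  using double_mod[of 0 k n] double_mod[of "- 1" k n] by (simp_all only: wheel_label.simps) simp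

lemma double_mod_inj:
  assumes "(c - 2 * int i) mod int (2 * n) = (c - 2 * int j) mod int (2 * n)" "i < n" "j < n"
  shows "i = j"
proof -
  have "int (2 * n) dvd (c - 2 * int i) - (c - 2 * int j)"
    using assms(1) by (rule mod_eq_dvd_iff[THEN iffD1])
  moreover have "(c - 2 * int i) - (c - 2 * int j) = 2 * (int j - int i)" "int (2 * n) = 2 * int n"
    by simp_all
  ultimately have "2 * int n dvd 2 * (int j - int i)" by (simp only:)
  then have "int n dvd int j - int i" by (simp only: dvd_mult_cancel_left) simp
  moreover have "\<bar>int j - int i\<bar> < int n" using assms by simp
  ultimately show ?thesis using zdvd_imp_le[of "int n" "\<bar>int j - int i\<bar>"] by fastforce
qed

text \<open>Keeps the labels of spokes and rim edges apart: the modulus is even, so parity survives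
  reduction.\<close>

lemma double_mod_parity: "(- 2 * i) mod int (2 * n) \<noteq> (- 1 - 2 * j) mod int (2 * n)"
proof
  assume "(- 2 * i) mod int (2 * n) = (- 1 - 2 * j) mod int (2 * n)"
  then have "int (2 * n) dvd (- 2 * i) - (- 1 - 2 * j)" by (rule mod_eq_dvd_iff[THEN iffD1])
  then have "2 dvd (- 2 * i) - (- 1 - 2 * j)" by (metis dvd_mult_left of_nat_mult of_nat_numeral)
  then show False by presburger
qed

text \<open>As \<open>joins\<close> is empty, each arc consists of the two segments joined over one
  edge, and arcs correspond to edges. \<open>Spoke i\<close> passes over the arcs of
  \<open>Spoke (i + 1)\<close> and \<open>Rim (i - 1)\<close>, and \<open>Rim i\<close> over those
  of \<open>Spoke i\<close> and \<open>Rim (i + 1)\<close>, with indices modulo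
  \<open>n\<close>.\<close>

lemma cyclic_diagram_wheel:
  assumes "n \<ge> 1"
  shows "cyclic_diagram (tait_diagram (wheel_graph n)) (2 * n) wheel_label"
    (is "cyclic_diagram ?D _ _")
proof
  have seg: "segments ?D = (Spoke ` {..<n} \<union> Rim ` {..<n}) \<times> UNIV"
    and cr: "crossings ?D = Spoke ` {..<n} \<union> Rim ` {..<n}"
    and over: "over ?D = (\<lambda>e. ((e, True), (e, False)))"
    and under: "under ?D = (\<lambda>e. (wheel_rotation n (e, True), wheel_rotation n (e, False)))"
    by (simp_all add: tait_diagram_def wheel_graph_def)
  have cont: "continues ?D = (\<lambda>e. ((e, True), (e, False))) ` crossings ?D"
    by (simp add: continues_def tait_diagram_def)
  show "0 < 2 * n" using assms by simp
  show "wheel_label s mod int (2 * n) = wheel_label t mod int (2 * n)" if "(s, t) \<in> continues ?D" for s t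
    using that unfolding cont cr by auto
  show "(s, t) \<in> arc_rel ?D"
    if st: "s \<in> segments ?D" "t \<in> segments ?D" "wheel_label s mod int (2 * n) = wheel_label t mod int (2 * n)"
    for s t
  proof -
    obtain e b e' b' where eb: "s = (e, b)" "t = (e', b')" by (cases s, cases t) blast
    have "e = e'"
    proof (cases e; cases e')
      fix i j assume "e = Spoke i" "e' = Spoke j"
      then show ?thesis
        using st double_mod_inj[of 0 i n j] unfolding eb seg by (auto simp del: of_nat_mult)
    next
      fix i j assume "e = Rim i" "e' = Rim j"
      then show ?thesis
        using st double_mod_inj[of "- 1" i n j] unfolding eb seg by (auto simp del: of_nat_mult)
    next
      fix i j assume "e = Spoke i" "e' = Rim j"
      then show ?thesis
        using st(3) double_mod_parity[of "int i" n "int j"] unfolding eb by (simp del: of_nat_mult)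
    next
      fix i j assume "e = Rim i" "e' = Spoke j"
      then show ?thesis
        using st(3) double_mod_parity[of "int j" n "int i"] unfolding eb by (simp del: of_nat_mult)
    qed
    then have "s = t \<or> (s, t) \<in> continues ?D \<union> (continues ?D)\<inverse>"
      using st(1) unfolding cont cr seg eb by (cases b; cases b') auto
    then have "(s, t) \<in> (continues ?D \<union> (continues ?D)\<inverse>)\<^sup>*" by blast
    then show ?thesis using st(1,2) by (simp add: arc_rel_def)
  qed
  show "{fst (over ?D c), fst (under ?D c), snd (under ?D c)} \<subseteq> segments ?D" if "c \<in> crossings ?D" for c
    using that assms unfolding over under seg cr by auto
  show "(wheel_label (fst (under ?D c)) mod int (2 * n) = (j + 1) mod int (2 * n) \<and>
       wheel_label (snd (under ?D c)) mod int (2 * n) = (j - 2) mod int (2 * n)) \<or>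
      (wheel_label (fst (under ?D c)) mod int (2 * n) = (j - 2) mod int (2 * n) \<and>
       wheel_label (snd (under ?D c)) mod int (2 * n) = (j + 1) mod int (2 * n))"
    if "c \<in> crossings ?D" "j = wheel_label (fst (over ?D c))" for c j
  proof (cases c)
    case (Spoke i)
    \<comment> \<open>The rotation uses \<open>i + n - 1\<close> to avoid truncated subtraction at
      \<open>i = 0\<close>; this moves the label by one full period \<open>2 * n\<close>.\<close>
    then have j: "- 2 * int (i + 1) = j - 2" "- 1 - 2 * int (i + n - 1) = j + 1 - int (2 * n)"
      using that(2) assms unfolding over by simp_all
    have "(j + 1 - int (2 * n)) mod int (2 * n) = (j + 1) mod int (2 * n)" by (rule minus_mod_self2)
    then show ?thesis
      unfolding under Spoke by (simp only: fst_conv snd_conv wheel_rotation.simps wheel_label_mod j simp_thms)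
  next
    case (Rim i)
    then have j: "- 1 - 2 * int (i + 1) = j - 2" "wheel_label (Spoke i, False) = j + 1"
      using that(2) unfolding over by simp_all
    show ?thesis
      unfolding under Rim by (simp only: fst_conv snd_conv wheel_rotation.simps wheel_label_mod j simp_thms)
  qed
  show "\<exists>c\<in>crossings ?D. wheel_label (fst (over ?D c)) mod int (2 * n) = j mod int (2 * n)" for j
  proof -
    \<comment> \<open>Labels run through \<open>0, -1, -2, ...\<close>, so the representative is
      taken of \<open>- j\<close>; its parity decides between spoke and rim.\<close>
    define m where "m = nat ((- j) mod int (2 * n))"
    have "int m = (- j) mod int (2 * n)" "m < 2 * n" using assms by (simp_all add: m_def nat_less_iff)
    then have m: "(- int m) mod int (2 * n) = j mod int (2 * n)" "m < 2 * n" by (simp_all add: mod_minus_eq)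
    show ?thesis
    proof (cases "even m")
      case True
      then obtain k where "m = 2 * k" by (rule evenE)
      then show ?thesis using m unfolding cr over by (intro bexI[of _ "Spoke k"]) auto
    next
      case False
      then obtain k where "m = 2 * k + 1" by (rule oddE)
      then show ?thesis using m unfolding cr over
        by (intro bexI[of _ "Rim k"]) (auto simp: algebra_simps)
    qed
  qed
qed

section \<open>Labelling of the closed braid\<close>

text \<open>Chosen so that the arc passing over at crossing \<open>t\<close> has label
  \<open>- t\<close>. The middle segment at level \<open>t\<close> has just passed over at crossing
  \<open>t - 1\<close>, one outer segment is about to pass over at crossing \<open>t\<close>, and
  the other one waits for crossing \<open>t + 1\<close>.\<close>

fun braid_label :: "nat \<times> nat \<Rightarrow> int" where
  "braid_label (t, p) =
     (if p = 2 then 1 - int t else if even t = (p = 1) then - int t else - 1 - int t)"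

lemma length_concat_replicate: "length (concat (replicate n xs)) = n * length xs"
  by (induction n) simp_all

lemma nth_concat_replicate_pair:
  "t < 2 * n \<Longrightarrow> concat (replicate n [x, y]) ! t = (if even t then x else y)"
proof (induction n arbitrary: t)
  case (Suc n)
  consider "t = 0" | "t = 1" | k where "t = Suc (Suc k)"
    by (metis One_nat_def not0_implies_Suc)
  then show ?case using Suc by cases auto
qed simp

text \<open>Up to closure, the arc \<open>- t\<close> emerges from below crossing
  \<open>t - 2\<close>, runs along an outer position, passes over at crossing \<open>t\<close> and
  ends in the middle at crossing \<open>t + 1\<close>. Read at crossing \<open>t\<close>, the
  underarcs are \<open>1 - t\<close> and \<open>- 2 - t\<close>.\<close>

lemma cyclic_diagram_braid:
  assumes "n \<ge> 1"
  shows "cyclic_diagram (wheel_closed_braid n) (2 * n) braid_label"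
    (is "cyclic_diagram ?D _ _")
proof
  define w where "w = concat (replicate n [Gen 1, Gen_inv 2])"
  have len: "length w = 2 * n" unfolding w_def length_concat_replicate by simp
  have nth: "w ! t = (if even t then Gen 1 else Gen_inv 2)" if "t < 2 * n" for t
    unfolding w_def by (rule nth_concat_replicate_pair[OF that])
  have D: "?D = braid_closure 3 w" unfolding wheel_closed_braid_def w_def ..
  have seg: "segments ?D = {0..2 * n} \<times> {1..3}" and cr: "crossings ?D = {..<2 * n}"
    unfolding D by (simp_all add: braid_closure_def len)
  have over: "over ?D t = (if even t then ((t, 1), (t + 1, 2)) else ((t, 3), (t + 1, 2)))"
    and under: "under ?D t = (if even t then ((t, 2), (t + 1, 1)) else ((t, 2), (t + 1, 3)))"
    if "t < 2 * n" for t
    using nth[OF that] unfolding D by (simp_all add: braid_closure_def)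
  have "joins ?D = {((t, p), (t + 1, p)) | t p. t < 2 * n \<and> p = (if even t then 3 else 1)} \<union>
      {((2 * n, p), (0, p)) | p. p \<in> {1..3}}"
  proof -
    have "p \<in> {1..3} \<and> p \<noteq> letter_pos (w ! t) \<and> p \<noteq> letter_pos (w ! t) + 1 \<longleftrightarrow>
        p = (if even t then 3 else 1)" if "t < 2 * n" for t p
      unfolding nth[OF that] by auto
    then show ?thesis
      unfolding D braid_closure_def len by (simp cong: conj_cong)
  qed
  then have cont_iff: "z \<in> continues ?D \<longleftrightarrow>
      (\<exists>t p. t < 2 * n \<and> p = (if even t then 3 else 1) \<and> z = ((t, p), (t + 1, p))) \<or>
      (\<exists>p\<in>{1..3}. z = ((2 * n, p), (0, p))) \<or>
      (\<exists>t<2 * n. z = ((t, if even t then 1 else 3), (t + 1, 2)))" for z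
    unfolding continues_def cr using over by (auto simp: image_iff)
  show "0 < 2 * n" using assms by simp
  show "braid_label s mod int (2 * n) = braid_label t mod int (2 * n)" if "(s, t) \<in> continues ?D" for s t
  proof -
    \<comment> \<open>Labels are constant inside the braid; only the closing strands change them, by
      \<open>2 * n\<close>. The three equations cover the three forms of a label at level
      \<open>2 * n\<close>.\<close>
    have "- int (2 * n) mod int (2 * n) = 0" "(1 - int (2 * n)) mod int (2 * n) = 1 mod int (2 * n)"
      "(- 1 - int (2 * n)) mod int (2 * n) = - 1 mod int (2 * n)"
      by (simp, (rule minus_mod_self2)+)
    then show ?thesis
      using that unfolding cont_iff by (auto simp del: of_nat_mult)
  qed
  \<comment> \<open>\<open>core t\<close> is the segment where the arc with label \<open>- t\<close> passes
    over at crossing \<open>t\<close>; every segment is linked to one of these.\<close>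
  define core where "core t = (t, if even t then 1 else 3 :: nat)" for t :: nat
  define S where "S = (continues ?D \<union> (continues ?D)\<inverse>)\<^sup>*"
  have step: "(s, t) \<in> S" if "(s, t) \<in> continues ?D \<or> (t, s) \<in> continues ?D" for s t
    using that unfolding S_def by blast
  have trans: "(s, u) \<in> S" if "(s, t) \<in> S" "(t, u) \<in> S" for s t u
    using that unfolding S_def by (rule rtrancl_trans)
  have sym: "(t, s) \<in> S" if "(s, t) \<in> S" for s t
    using that sym_rtrancl[OF sym_Un_converse] unfolding S_def by (metis symD)
  have under_core: "((t + 1, 2), core t) \<in> S" if "t < 2 * n" for t
    by (rule step) (use that in \<open>simp add: cont_iff core_def\<close>)
  have wrap: "((2 * n, p), (0, p)) \<in> S" if "p \<in> {1..3}" for p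
    by (rule step) (use that in \<open>simp add: cont_iff\<close>)
  have core_wrap: "(core (2 * n), core 0) \<in> S" using wrap[of 1] by (simp add: core_def)
  have side: "((t, if even t then 3 else 1), core (t + 1)) \<in> S" if "t < 2 * n" for t
    by (rule step) (use that in \<open>simp add: cont_iff core_def\<close>)
  have core_label: "\<exists>m<2 * n. (s, core m) \<in> S \<and> (- int m) mod int (2 * n) = braid_label s mod int (2 * n)"
    if s: "s \<in> segments ?D" for s
  proof -
    \<comment> \<open>Segments have levels \<open>0\<close> to \<open>2 * n\<close> inclusive, while
      crossings stop at \<open>2 * n - 1\<close>; the index \<open>2 * n\<close> is replaced by
      \<open>0\<close> through the closing strand.\<close>
    have reduce: "\<exists>m<2 * n. (s, core m) \<in> S \<and> (- int m) mod int (2 * n) = braid_label s mod int (2 * n)"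
      if "(s, core k) \<in> S" "k \<le> 2 * n" "braid_label s mod int (2 * n) = (- int k) mod int (2 * n)" for k
    proof (cases "k = 2 * n")
      case True
      then show ?thesis using that trans[OF _ core_wrap, of s] assms
        by (intro exI[of _ 0]) simp
    next
      case False
      then show ?thesis using that by (intro exI[of _ k]) simp
    qed
    obtain t p where tp: "s = (t, p)" "t \<le> 2 * n" "p \<in> {1..3}" using s unfolding seg by auto
    \<comment> \<open>The middle segment at level 0 and the waiting outer segment at level
      \<open>2 * n\<close> reach their cores only through the closing strands, at crossings
      \<open>2 * n - 1\<close> and \<open>1\<close> respectively.\<close>
    consider "p = 2" "t > 0" | "p = 2" "t = 0" | "p \<noteq> 2" "even t = (p = 1)"
      | "p \<noteq> 2" "even t \<noteq> (p = 1)" "t < 2 * n" | "p \<noteq> 2" "even t \<noteq> (p = 1)" "t = 2 * n"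
      using tp by linarith
    then show ?thesis
    proof cases
      case 1
      then show ?thesis using under_core[of "t - 1"] tp by (intro reduce[of "t - 1"]) (auto simp: of_nat_diff)
    next
      case 2
      have "(1 - int (2 * n)) mod int (2 * n) = 1 mod int (2 * n)" by (rule minus_mod_self2)
      then show ?thesis
        using trans[OF sym[OF wrap[of 2]], of "core (2 * n - 1)"] under_core[of "2 * n - 1"] 2 tp assms
        by (intro reduce[of "2 * n - 1"]) (auto simp: of_nat_diff)
    next
      case 3
      then have "s = core t" using tp by (auto simp: core_def)
      then show ?thesis using tp(2) by (intro reduce[of t]) (simp_all add: S_def core_def)
    next
      case 4
      then have "p = (if even t then 3 else 1)" using tp by auto
      then show ?thesis using side[of t] 4 tp by (intro reduce[of "t + 1"]) auto
    next
      case 5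
      then have "p = 3" using tp by auto
      have "(- 1 - int (2 * n)) mod int (2 * n) = - 1 mod int (2 * n)" by (rule minus_mod_self2)
      then show ?thesis
        using trans[OF wrap[of 3], of "core 1"] side[of 0] 5 tp \<open>p = 3\<close> assms
        by (intro reduce[of 1]) (auto simp: algebra_simps)
    qed
  qed
  show "(s, t) \<in> arc_rel ?D"
    if st: "s \<in> segments ?D" "t \<in> segments ?D" "braid_label s mod int (2 * n) = braid_label t mod int (2 * n)"
    for s t
  proof -
    obtain i j where ij: "i < 2 * n" "(s, core i) \<in> S" "(- int i) mod int (2 * n) = braid_label s mod int (2 * n)"
      "j < 2 * n" "(t, core j) \<in> S" "(- int j) mod int (2 * n) = braid_label t mod int (2 * n)"
      using core_label[OF st(1)] core_label[OF st(2)] by blast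
    have "int (2 * n) dvd - int i - - int j" using ij st(3) by (intro mod_eq_dvd_iff[THEN iffD1]) simp
    then have "i = j" using ij(1,4) zdvd_imp_le[of "int (2 * n)" "\<bar>- int i - - int j\<bar>"] by fastforce
    then have "(s, t) \<in> S" using ij(2) sym[OF ij(5)] trans by blast
    then show ?thesis using st(1,2) by (simp add: arc_rel_def S_def)
  qed
  show "{fst (over ?D c), fst (under ?D c), snd (under ?D c)} \<subseteq> segments ?D" if "c \<in> crossings ?D" for c
    using that over[of c] under[of c] unfolding seg cr by auto
  show "(braid_label (fst (under ?D c)) mod int (2 * n) = (j + 1) mod int (2 * n) \<and>
       braid_label (snd (under ?D c)) mod int (2 * n) = (j - 2) mod int (2 * n)) \<or>
      (braid_label (fst (under ?D c)) mod int (2 * n) = (j - 2) mod int (2 * n) \<and>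
       braid_label (snd (under ?D c)) mod int (2 * n) = (j + 1) mod int (2 * n))"
    if "c \<in> crossings ?D" "j = braid_label (fst (over ?D c))" for c j
    using that over[of c] under[of c] unfolding cr by (auto simp: algebra_simps)
  show "\<exists>c\<in>crossings ?D. braid_label (fst (over ?D c)) mod int (2 * n) = j mod int (2 * n)" for j
  proof -
    define m where "m = nat ((- j) mod int (2 * n))"
    have "int m = (- j) mod int (2 * n)" "m < 2 * n" using assms by (simp_all add: m_def nat_less_iff)
    then have m: "(- int m) mod int (2 * n) = j mod int (2 * n)" by (auto simp: mod_minus_eq)
    show ?thesis using m \<open>m < 2 * n\<close> over[of m] unfolding cr by (intro bexI[of _ m]) auto
  qed
qed

section \<open>Transport along isomorphisms and the small cases\<close>

lemma has_Col_red_iso: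
  assumes "has_Col_red D G" "G \<cong> H"
  shows "has_Col_red D H"
  using assms unfolding has_Col_red_def by (blast intro: iso_trans)

text \<open>Needed for \<open>n = 2\<close>, where \<open>F 2 = 1\<close> makes the second factor
  trivial.\<close>

lemma DirProd_integer_mod_group_1_iso:
  "integer_mod_group m \<times>\<times> integer_mod_group 1 \<cong> integer_mod_group m"
proof -
  have "fst \<in> iso (integer_mod_group m \<times>\<times> integer_mod_group 1) (integer_mod_group m)"
    by (auto simp: iso_def hom_def bij_betw_def inj_on_def carrier_integer_mod_group image_iff)
  then show ?thesis by (auto simp: is_iso_def)
qed



theorem theorem1p6:
  shows
   "(\<forall>n\<ge>1.
       (odd n \<longrightarrow>
          has_Col_red (wheel_closed_braid n)
            (integer_mod_group (fib (n - 1) + fib (n + 1)) \<times>\<times>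
             integer_mod_group (fib (n - 1) + fib (n + 1))) \<and>
          has_Col_red (tait_diagram (wheel_graph n))
            (integer_mod_group (fib (n - 1) + fib (n + 1)) \<times>\<times>
             integer_mod_group (fib (n - 1) + fib (n + 1)))) \<and>
       (even n \<longrightarrow>
          has_Col_red (wheel_closed_braid n)
            (integer_mod_group (5 * fib n) \<times>\<times> integer_mod_group (fib n)) \<and>
          has_Col_red (tait_diagram (wheel_graph n))
            (integer_mod_group (5 * fib n) \<times>\<times> integer_mod_group (fib n)))) \<and>
    has_Col_red (wheel_closed_braid 2) (integer_mod_group 5) \<and>
    has_Col_red (wheel_closed_braid 3) (integer_mod_group 4 \<times>\<times> integer_mod_group 4) \<and>
    has_Col_red (wheel_closed_braid 4) (integer_mod_group 15 \<times>\<times> integer_mod_group 3) \<and>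
    has_Col_red (wheel_closed_braid 5) (integer_mod_group 11 \<times>\<times> integer_mod_group 11) \<and>
    has_Col_red (wheel_closed_braid 6) (integer_mod_group 40 \<times>\<times> integer_mod_group 8) \<and>
    has_Col_red (wheel_closed_braid 7) (integer_mod_group 29 \<times>\<times> integer_mod_group 29) \<and>
    has_Col_red (tait_diagram (wheel_graph 2)) (integer_mod_group 5) \<and>
    has_Col_red (tait_diagram (wheel_graph 3)) (integer_mod_group 4 \<times>\<times> integer_mod_group 4) \<and>
    has_Col_red (tait_diagram (wheel_graph 4)) (integer_mod_group 15 \<times>\<times> integer_mod_group 3) \<and>
    has_Col_red (tait_diagram (wheel_graph 5)) (integer_mod_group 11 \<times>\<times> integer_mod_group 11) \<and>
    has_Col_red (tait_diagram (wheel_graph 6)) (integer_mod_group 40 \<times>\<times> integer_mod_group 8) \<and>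
    has_Col_red (tait_diagram (wheel_graph 7)) (integer_mod_group 29 \<times>\<times> integer_mod_group 29)"
proof -
  note wheel = cyclic_diagram_Col_red[OF cyclic_diagram_wheel]
    and braid = cyclic_diagram_Col_red[OF cyclic_diagram_braid]
  have fib: "fib 4 = 3" "fib 6 = 8" "fib 8 = 21" by (simp_all add: eval_nat_numeral)
  have iso: "integer_mod_group (5 * fib 2) \<times>\<times> integer_mod_group (fib 2) \<cong> integer_mod_group 5"
    using DirProd_integer_mod_group_1_iso[of 5] by simp
  show ?thesis
  proof (intro conjI allI impI)
    show "has_Col_red (wheel_closed_braid 2) (integer_mod_group 5)"
      "has_Col_red (tait_diagram (wheel_graph 2)) (integer_mod_group 5)"
      using has_Col_red_iso[OF braid(2) iso] has_Col_red_iso[OF wheel(2) iso] by simp_all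
  qed (use wheel wheel(1)[of 3] wheel(1)[of 5] wheel(1)[of 7] wheel(2)[of 4] wheel(2)[of 6]
      braid braid(1)[of 3] braid(1)[of 5] braid(1)[of 7] braid(2)[of 4] braid(2)[of 6] in \<open>simp_all add: fib\<close>)
qed

end
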